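(* Let $\mathcal S$ be a compact Hausdorff space, and let $\mu$ be a content on $\mathfrak R(\mathcal S)$. There is a unique normal Borel probability measure $\nu$ on $\mathcal S$ such that $$\fint_{\mathcal S}f\,d\mu=\int_{\mathcal S}f\,d\nu\qquad\text{for all } f\in\mathcal C(\mathcal S,\mathbb R).$$ Furthermore, there is a unique liminal density structure $\{\phi_R\}_{R\in\mathfrak R(\mathcal S)}$ which is subordinate to $\nu$ and which satisfies $$\mu[R]=\nu(R)+\int_{\partial R}\phi_R\,d\nu\qquad\text{and}\qquad\fint_R f\,d\mu=\int_R f\,d\nu+\int_{\partial R}f\,\phi_R\,d\nu$$ for all $R\in\mathfrak R(\mathcal S)$ and all $f\in\mathcal C(\mathcal S,\mathbb R)$.
   Context: $\mathcal C(\mathcal S,\mathbb R)$ is the space of continuous real-valued functions on $\mathcal S$; $\partial R$ denotes the topological boundary of $R$. An open set $R\subseteq\mathcal S$ is regular if $R=\mathrm{int}(\mathrm{clos}(R))$. $\mathfrak R(\mathcal S)$ is the set of regular open subsets; it is a Boolean algebra with meet $\cap$, join $Q\vee R:=\mathrm{int}(\mathrm{clos}(Q\cup R))$ and complement $\neg R:=\mathrm{int}(\mathcal S\setminus R)$. A content on $\mathfrak R(\mathcal S)$ is a function $\mu:\mathfrak R(\mathcal S)\to[0,\infty)$ such that $\mu[R_1\vee\cdots\vee R_N]=\sum_n\mu[R_n]$ for every finite collection of disjoint regular open sets; by standing assumption $\mu[\mathcal S]=1$. A regular partition of $\mathcal S$ is a finite collection of disjoint elements of $\mathfrak R(\mathcal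 S)$ with join $\mathcal S$. Integral against a content: call $f:\mathcal S\to\mathbb R$ simple if it is constant on each cell of some regular partition of $\mathcal S$ (values off the cells are arbitrary). For $R\in\mathfrak R(\mathcal S)$ and bounded simple $f$ with value $r_n$ on the cell $P_n$, $\fint_R f\,d\mu:=\sum_n r_n\mu[P_n\cap R]$. Every bounded continuous $g:\mathcal S\to\mathbb R$ is a uniform limit of simple functions, and $\fint_R g\,d\mu$ is the supremum of $\fint_R f\,d\mu$ over all bounded simple $f$ with $f\le g$ on $R$. A Borel measure $\nu$ is normal if for every Borel set $B$, $\nu[B]=\sup\{\nu[C]: C\subseteq B,\ C\text{ closed}\}$ and $\nu[B]=\inf\{\nu[O]: B\subseteq O,\ O\text{ open}\}$. Given a Borel measure $\nu$ on $\mathcal S$, a liminal density structure subordinate to $\nu$ is a collection $\{\phi_R\}_{R\in\mathfrak R(\mathcal S)}$, where $\phi_R\in L^1(\partial R,\nu;[0,1])$ is (the $\nu$-a.e. class of) a $[0,1]$-valued $\nu$-integrable function on $\partial R$, such that for every regular partition $\{R_1,\dots,R_N\}$ of $\mathcal S$, $\phi_{R_1}+\cdots+\phi_{R_N}=1$ $\nu$-almost everywhere on $\partial R_1\cup\cdots\cup\partial R_N$ (each $\phi_{R_n}$ being extended by $0$ off $\partial R_n$). *)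

theory Defs
  imports "HOL-Probability.Probability"
begin

text \<open>The compact Hausdorff space is a type of class \<^class>\<open>t2_space\<close> whose universe is
  compact; the whole space is \<^term>\<open>UNIV\<close>.\<close>

definition regular_open :: "'a::topological_space set \<Rightarrow> bool" where
  "regular_open R \<longleftrightarrow> R = interior (closure R)"

definition reg_join :: "'a::topological_space set \<Rightarrow> 'a set \<Rightarrow> 'a set" where
  "reg_join Q R = interior (closure (Q \<union> R))"

definition reg_Join :: "'a::topological_space set set \<Rightarrow> 'a set" where
  "reg_Join \<R> = interior (closure (\<Union>\<R>))"

text \<open>The finitary join of regular open sets is the iterated binary join of the Boolean algebra.\<close>

lemma reg_Join_empty: "reg_Join {} = {}"
  by (simp add: reg_Join_def)

lemma reg_Join_insert:
  assumes "regular_open R" "\<And>Q. Q \<in> \<R> \<Longrightarrow> regular_open Q"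
  shows "reg_Join (insert R \<R>) = reg_join R (reg_Join \<R>)"
proof -
  let ?U = "\<Union>\<R>"
  have "open ?U"
    using assms(2) by (metis open_Union open_interior regular_open_def)
  then have "?U \<subseteq> interior (closure ?U)"
    by (simp add: closure_subset interior_maximal)
  then have "closure (R \<union> ?U) \<subseteq> closure (R \<union> interior (closure ?U))"
    by (intro closure_mono) auto
  moreover have "closure (R \<union> interior (closure ?U)) \<subseteq> closure (R \<union> ?U)"
    by (intro closure_minimal)
       (use closure_subset[of R] interior_subset[of "closure ?U"] in \<open>auto simp: closure_Un\<close>)
  ultimately have "closure (R \<union> ?U) = closure (R \<union> interior (closure ?U))"
    by (rule subset_antisym)
  then show ?thesis
    unfolding reg_Join_def reg_join_def by (metis Union_insert)
qed

text \<open>Only the values on regular open sets are relevant. The normalisation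
  \<open>\<mu> UNIV = 1\<close> is the standing assumption on contents.\<close>

definition reg_content :: "('a::topological_space set \<Rightarrow> real) \<Rightarrow> bool" where
  "reg_content \<mu> \<longleftrightarrow>
     (\<forall>R. regular_open R \<longrightarrow> 0 \<le> \<mu> R) \<and>
     (\<forall>\<R>. finite \<R> \<and> (\<forall>R\<in>\<R>. regular_open R) \<and> disjoint \<R> \<longrightarrow>
        \<mu> (reg_Join \<R>) = (\<Sum>R\<in>\<R>. \<mu> R)) \<and>
     \<mu> UNIV = 1"

definition regular_partition :: "'a::topological_space set set \<Rightarrow> bool" where
  "regular_partition \<P> \<longleftrightarrow>
     finite \<P> \<and> (\<forall>P\<in>\<P>. regular_open P) \<and> disjoint \<P> \<and> reg_Join \<P> = UNIV"

text \<open>\<open>has_simple_fint \<mu> R f I\<close>: \<open>f\<close> is simple and its integral over \<open>R\<close> is \<open>I\<close>, as computed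
  from some regular partition with \<open>f = r P\<close> on each cell \<open>P\<close>.\<close>

definition has_simple_fint ::
    "('a::topological_space set \<Rightarrow> real) \<Rightarrow> 'a set \<Rightarrow> ('a \<Rightarrow> real) \<Rightarrow> real \<Rightarrow> bool" where
  "has_simple_fint \<mu> R f I \<longleftrightarrow>
     (\<exists>\<P> r. regular_partition \<P> \<and> (\<forall>P\<in>\<P>. \<forall>x\<in>P. f x = r P) \<and>
        I = (\<Sum>P\<in>\<P>. r P * \<mu> (P \<inter> R)))"

text \<open>The integral of a bounded continuous function against a content. The inequality
  \<open>f \<le> g\<close> is required on all of \<open>R\<close>, including points outside the cells of \<open>f\<close>.\<close>

definition fint :: "('a::topological_space set \<Rightarrow> real) \<Rightarrow> 'a set \<Rightarrow> ('a \<Rightarrow> real) \<Rightarrow> real" where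
  "fint \<mu> R g =
     Sup {I. \<exists>f. bounded (range f) \<and> has_simple_fint \<mu> R f I \<and> (\<forall>x\<in>R. f x \<le> g x)}"

definition normal_measure :: "'a::topological_space measure \<Rightarrow> bool" where
  "normal_measure \<nu> \<longleftrightarrow> sets \<nu> = sets borel \<and>
     (\<forall>B\<in>sets borel.
        emeasure \<nu> B = (SUP C\<in>{C. closed C \<and> C \<subseteq> B}. emeasure \<nu> C) \<and>
        emeasure \<nu> B = (INF V\<in>{V. open V \<and> B \<subseteq> V}. emeasure \<nu> V))"

text \<open>The class of \<open>\<phi> R\<close> in \<open>L\<^sup>1\<close> is given by a \<open>[0,1]\<close>-valued representative, whose values outside
  \<open>frontier R\<close> are irrelevant; the indicator implements extension by \<open>0\<close>.\<close>

definition liminal_density_structure ::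
    "'a::topological_space measure \<Rightarrow> ('a set \<Rightarrow> 'a \<Rightarrow> real) \<Rightarrow> bool" where
  "liminal_density_structure \<nu> \<phi> \<longleftrightarrow>
     (\<forall>R. regular_open R \<longrightarrow>
        set_integrable \<nu> (frontier R) (\<phi> R) \<and> (\<forall>x\<in>frontier R. \<phi> R x \<in> {0..1})) \<and>
     (\<forall>\<P>. regular_partition \<P> \<longrightarrow>
        (AE x in \<nu>. x \<in> (\<Union>R\<in>\<P>. frontier R) \<longrightarrow>
           (\<Sum>R\<in>\<P>. indicat_real (frontier R) x * \<phi> R x) = 1))"

text \<open>Equality of liminal density structures: equality of the \<open>\<nu>\<close>-a.e. classes on each boundary.\<close>

definition liminal_eq ::
    "'a::topological_space measure \<Rightarrow> ('a set \<Rightarrow> 'a \<Rightarrow> real) \<Rightarrow> ('a set \<Rightarrow> 'a \<Rightarrow> real) \<Rightarrow> bool" where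
  "liminal_eq \<nu> \<phi> \<psi> \<longleftrightarrow>
     (\<forall>R. regular_open R \<longrightarrow> (AE x in \<nu>. x \<in> frontier R \<longrightarrow> \<phi> R x = \<psi> R x))"

text \<open>\<open>\<nu>\<close> is a normal Borel probability measure representing \<open>\<mu>\<close> on continuous functions.\<close>

definition represents_content ::
    "('a::topological_space set \<Rightarrow> real) \<Rightarrow> 'a measure \<Rightarrow> bool" where
  "represents_content \<mu> \<nu> \<longleftrightarrow> normal_measure \<nu> \<and> prob_space \<nu> \<and>
     (\<forall>f. continuous_on UNIV f \<longrightarrow> fint \<mu> UNIV f = (LINT x|\<nu>. f x))"

text \<open>\<open>\<phi>\<close> is a liminal density structure subordinate to \<open>\<nu>\<close> which recovers \<open>\<mu>\<close> and its integrals.\<close>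

definition liminal_representation ::
    "('a::topological_space set \<Rightarrow> real) \<Rightarrow> 'a measure \<Rightarrow> ('a set \<Rightarrow> 'a \<Rightarrow> real) \<Rightarrow> bool" where
  "liminal_representation \<mu> \<nu> \<phi> \<longleftrightarrow> liminal_density_structure \<nu> \<phi> \<and>
     (\<forall>R. regular_open R \<longrightarrow>
        \<mu> R = measure \<nu> R + (LINT x:frontier R|\<nu>. \<phi> R x) \<and>
        (\<forall>f. continuous_on UNIV f \<longrightarrow>
           fint \<mu> R f = (LINT x:R|\<nu>. f x) + (LINT x:frontier R|\<nu>. f x * \<phi> R x)))"

end

theory Submission
  imports Defs
begin

text \<open>For a regular open \<open>R\<close>, the map \<open>Q \<mapsto> \<mu> (Q \<inter> R)\<close> is again a (not normalised) content. Every such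
  content \<open>c\<close> extends to a normal Borel measure \<open>\<nu>\<^sub>c\<close>: put \<open>\<lambda> V = sup {c Q | closure Q \<subseteq> V}\<close> for open
  \<open>V\<close>, take the induced outer measure, and check that open sets are Caratheodory measurable. Over a
  regular partition the measures \<open>\<nu>\<^sub>P\<close> of the contents \<open>\<mu> (\<cdot> \<inter> P)\<close> add up to \<open>\<nu>\<close>, and \<open>\<nu>\<^sub>P\<close> lives on
  \<open>closure P\<close>. Comparing integrals on the cells of a partition on which \<open>f\<close> oscillates little shows that
  integrating \<open>f\<close> over \<open>R\<close> against \<open>\<mu>\<close> is integrating \<open>f\<close> against \<open>\<nu>\<^sub>R\<close>. The liminal density
  \<open>\<phi>\<^sub>R\<close> is the Radon--Nikodym derivative of \<open>\<nu>\<^sub>R\<close> with respect to \<open>\<nu>\<close>, which is \<open>1\<close> on \<open>R\<close> and \<open>0\<close> off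
  \<open>closure R\<close>. Both uniqueness claims hold because Urysohn functions determine outer regular measures
  on closed sets.\<close>

subsection \<open>Regular open sets and regular partitions\<close>

lemma regular_open_imp_open: "regular_open R \<Longrightarrow> open R"
  by (metis open_interior regular_open_def)

lemma regular_open_interior_closure: "regular_open (interior (closure A))"
proof -
  have "closure (interior (closure A)) \<subseteq> closure A"
    by (simp add: closure_minimal interior_subset)
  moreover have "interior (closure A) \<subseteq> closure (interior (closure A))"
    by (rule closure_subset)
  ultimately show ?thesis
    unfolding regular_open_def
    by (intro antisym interior_maximal open_interior interior_mono)
qed

lemma regular_open_Int: "regular_open Q \<Longrightarrow> regular_open R \<Longrightarrow> regular_open (Q \<inter> R)"
proof -
  assume Q: "regular_open Q" and R: "regular_open R"
  have "interior (closure (Q \<inter> R)) \<subseteq> interior (closure Q) \<inter> interior (closure R)"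
    by (intro Int_greatest interior_mono closure_mono) auto
  moreover have "Q \<inter> R \<subseteq> interior (closure (Q \<inter> R))"
    using Q R by (intro interior_maximal closure_subset open_Int regular_open_imp_open)
  ultimately show ?thesis
    using Q R unfolding regular_open_def by blast
qed

lemma regular_open_Compl_closure: "regular_open R \<Longrightarrow> regular_open (- closure R)"
  unfolding regular_open_def
  by (simp add: closure_complement interior_complement)

lemma regular_open_empty [simp]: "regular_open {}"
  and regular_open_UNIV [simp]: "regular_open UNIV"
  by (simp_all add: regular_open_def)

lemma regular_open_Diff_closure: "regular_open Q \<Longrightarrow> regular_open R \<Longrightarrow> regular_open (Q - closure R)"
  by (simp add: Diff_eq regular_open_Int regular_open_Compl_closure)

lemma regular_open_disjoint_closure: "regular_open Q \<Longrightarrow> Q \<inter> R = {} \<Longrightarrow> Q \<inter> closure R = {}"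
  by (simp add: open_Int_closure_eq_empty regular_open_imp_open)

lemma regular_partition_dense: "regular_partition \<P> \<Longrightarrow> closure (\<Union>\<P>) = UNIV"
  unfolding regular_partition_def reg_Join_def
  by (metis UNIV_I interior_subset subsetD top.extremum_uniqueI)

lemma regular_partitionI:
  assumes "finite \<P>" "\<And>P. P \<in> \<P> \<Longrightarrow> regular_open P" "disjoint \<P>" "closure (\<Union>\<P>) = UNIV"
  shows "regular_partition \<P>"
  using assms by (simp add: regular_partition_def reg_Join_def)

lemma regular_partition_regular: "regular_partition \<P> \<Longrightarrow> P \<in> \<P> \<Longrightarrow> regular_open P"
  and regular_partition_finite: "regular_partition \<P> \<Longrightarrow> finite \<P>"
  by (simp_all add: regular_partition_def)

lemma regular_partition_unique_cell:
  "regular_partition \<P> \<Longrightarrow> P \<in> \<P> \<Longrightarrow> Q \<in> \<P> \<Longrightarrow> x \<in> P \<Longrightarrow> x \<in> Q \<Longrightarrow> P = Q"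
  by (auto simp: regular_partition_def disjoint_def)

lemma regular_partition_complement:
  assumes "regular_open R"
  shows "regular_partition {R, - closure R}"
proof (rule regular_partitionI)
  have "closure (\<Union>{R, - closure R}) = closure R \<union> - interior (closure R)"
    by (simp add: closure_complement)
  then show "closure (\<Union>{R, - closure R}) = UNIV"
    using interior_subset by fastforce
  show "disjoint {R, - closure R}"
    using closure_subset[of R] by (auto simp: disjoint_def)
qed (use assms regular_open_Compl_closure in auto)

text \<open>The range of \<open>g\<close> is cut into layers of height \<open>e\<close>, and each
  cell is an open region on which \<open>g\<close> stays in one layer. The points in no cell form a
  nowhere dense set, so the cells still join to the whole space.\<close>

lemma regular_partition_fine:
  fixes g :: "'a::topological_space \<Rightarrow> real"
  assumes g: "continuous_on UNIV g" and bdd: "bounded (range g)" and "e > 0"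
  obtains \<P> where "regular_partition \<P>" "\<And>P x y. P \<in> \<P> \<Longrightarrow> x \<in> P \<Longrightarrow> y \<in> P \<Longrightarrow> g x \<le> g y + e"
proof -
  obtain M where M: "\<And>x. \<bar>g x\<bar> \<le> M"
    using bdd by (auto simp: bounded_iff)
  define t where "t k = - M + e * real k" for k
  \<comment> \<open>Regularising a sublevel set keeps it between \<open>{x. g x < t k}\<close> and
    \<open>{x. g x \<le> t k}\<close>, so the bounds for \<open>g\<close> on the slices
    survive.\<close>
  define U where "U k = interior (closure {x. g x < t k})" for k
  define P where "P k = U (Suc k) - closure (U k)" for k
  \<comment> \<open>With \<open>N\<close> layers above \<open>- M\<close>, the level
    \<open>t N\<close> exceeds \<open>M\<close>, so \<open>U N\<close> is everything.\<close>
  obtain N where N: "real N * e > 2 * M"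
    using \<open>e > 0\<close> reals_Archimedean3 by blast
  have opn: "open {x. g x < a}" for a
    by (intro open_Collect_less g continuous_on_const)
  have clo: "closed {x. g x \<le> a}" for a
    by (intro closed_Collect_le g continuous_on_const)
  have U_le: "g x \<le> t k" if "x \<in> U k" for x k
  proof -
    have "closure {x. g x < t k} \<subseteq> {x. g x \<le> t k}"
      by (intro closure_minimal clo) auto
    then show ?thesis using that interior_subset unfolding U_def by blast
  qed
  have U_ge: "{x. g x < t k} \<subseteq> U k" for k
    unfolding U_def by (intro interior_maximal closure_subset opn)
  have U_mono: "U j \<subseteq> U k" if "j \<le> k" for j k
  proof -
    have "t j \<le> t k" using that \<open>e > 0\<close> by (simp add: t_def)
    then show ?thesis unfolding U_def by (intro interior_mono closure_mono) auto
  qed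
  have U0: "U 0 = {}"
  proof -
    have "- M \<le> g x" for x using M[of x] by linarith
    then have "{x. g x < t 0} = {}" by (auto simp: t_def not_less)
    then show ?thesis by (simp add: U_def)
  qed
  have UN: "U N = UNIV"
  proof -
    have "g x < t N" for x using M[of x] N by (simp add: t_def mult.commute)
    then show ?thesis using U_ge[of N] by auto
  qed
  have regU: "regular_open (U k)" for k
    by (simp add: U_def regular_open_interior_closure)
  have regP: "regular_open (P k)" for k
    by (simp add: P_def regU regular_open_Diff_closure)
  have lt: "P j \<inter> P k = {}" if "j < k" for j k
    using U_mono[of "Suc j" k] that closure_subset[of "U k"] by (auto simp: P_def)
  have disj: "P j \<inter> P k = {}" if "j \<noteq> k" for j k
    using lt[of j k] lt[of k j] that by (cases "j < k") auto
  have dense: "closure (\<Union>(P ` {..<N})) = UNIV"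
  proof (rule ccontr)
    define W where "W = - closure (\<Union>(P ` {..<N}))"
    assume "closure (\<Union>(P ` {..<N})) \<noteq> UNIV"
    then have ne: "W \<inter> U N \<noteq> {}" by (auto simp: W_def UN)
    \<comment> \<open>An open \<open>W\<close> missing every slice meets a first \<open>U k\<close>,
      and \<open>k = Suc j\<close> because \<open>U 0\<close> is empty. Missing \<open>U j\<close>,
      it also misses \<open>closure (U j)\<close>, hence meets the slice \<open>P j\<close>.\<close>
    define k where "k = (LEAST k. W \<inter> U k \<noteq> {})"
    have k: "W \<inter> U k \<noteq> {}" unfolding k_def using ne by (rule LeastI)
    have kN: "k \<le> N" unfolding k_def using ne by (rule Least_le)
    obtain j where j: "k = Suc j" using k U0 by (cases k) auto
    have "W \<inter> U j = {}"
      using not_less_Least[of j "\<lambda>k. W \<inter> U k \<noteq> {}"] j by (auto simp: k_def)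
    then have "W \<inter> closure (U j) = {}"
      by (subst open_Int_closure_eq_empty) (auto simp: W_def)
    then have "W \<inter> P j \<noteq> {}" using k by (auto simp: P_def j)
    moreover have "P j \<subseteq> closure (\<Union>(P ` {..<N}))"
      using kN j by (intro order_trans[OF _ closure_subset] UN_upper) simp
    ultimately show False by (auto simp: W_def)
  qed
  show thesis
  proof
    show "regular_partition (P ` {..<N})"
      by (intro regular_partitionI) (use regP dense in \<open>auto simp: disjoint_def intro!: disj\<close>)
    fix Q x y assume "Q \<in> P ` {..<N}" "x \<in> Q" "y \<in> Q"
    then obtain k where k: "x \<in> P k" "y \<in> P k" by auto
    have "g x \<le> t (Suc k)" using k U_le by (auto simp: P_def)
    moreover have "t k \<le> g y"
      using k U_ge[of k] closure_subset[of "U k"] by (auto simp: P_def not_less[symmetric])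
    ultimately show "g x \<le> g y + e" by (simp add: t_def algebra_simps)
  qed
qed

section \<open>Separation in compact Hausdorff spaces\<close>

lemma normal_space_euclidean_compact:
  "compact (UNIV :: 'a::t2_space set) \<Longrightarrow> normal_space (euclidean :: 'a topology)"
  by (intro compact_Hausdorff_or_regular_imp_normal_space)
     (simp_all add: compact_space_def Hausdorff_space_def disjnt_def, metis hausdorff)

text \<open>Normality yields an open set whose closure lies in \<open>V\<close>; regularising it
  enlarges it only within that closure.\<close>

lemma regular_open_between:
  fixes C V :: "'a::t2_space set"
  assumes "compact (UNIV :: 'a set)" "closed C" "open V" "C \<subseteq> V"
  obtains R where "regular_open R" "C \<subseteq> R" "closure R \<subseteq> V"
proof -
  have "\<exists>U. openin euclidean U \<and> C \<subseteq> U \<and> euclidean closure_of U \<subseteq> V"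
    using normal_space_euclidean_compact[OF assms(1), unfolded normal_space_alt, rule_format, of C V]
      assms(2-) by simp
  then obtain U where U: "open U" "C \<subseteq> U" "closure U \<subseteq> V"
    by auto
  have "closure (interior (closure U)) \<subseteq> closure U"
    by (simp add: closure_minimal interior_subset)
  then show thesis
    using U closure_subset[of U] interior_maximal[OF closure_subset[of U]]
    by (intro that[OF regular_open_interior_closure[of U]]) (meson subset_trans)+
qed

text \<open>Urysohn's lemma in terms of indicators, so that the integral of \<open>f\<close> lies
  between the measures of \<open>C\<close> and \<open>V\<close>.\<close>

lemma urysohn_function:
  fixes C V :: "'a::t2_space set"
  assumes "compact (UNIV :: 'a set)" "closed C" "open V" "C \<subseteq> V"
  obtains f :: "'a \<Rightarrow> real" where "continuous_on UNIV f" "indicat_real C \<le> f" "f \<le> indicat_real V"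
proof -
  have "closedin euclidean C" "closedin euclidean (- V)" "disjnt (- V) C"
    using assms by (auto simp: disjnt_def)
  then obtain f where f: "continuous_map euclidean (top_of_set {0..1::real}) f"
      "f ` (- V) \<subseteq> {0}" "f ` C \<subseteq> {1}"
    using Urysohn_lemma[OF normal_space_euclidean_compact[OF assms(1)], of "- V" C 0 1] by auto
  then have "continuous_on UNIV f" "\<And>x. f x \<in> {0..1}"
    by (auto simp: continuous_map_in_subtopology)
  with f show thesis
    by (intro that[of f]) (auto simp: le_fun_def indicator_def image_subset_iff)
qed

subsection \<open>The normal measure induced by a content\<close>

text \<open>Directedness supplies one index that serves all summands at once, which lets the
  supremum pass through a finite sum; the induction reduces this to two summands.\<close>

lemma SUP_sum_directed_ennreal:
  fixes f :: "'i \<Rightarrow> 'b \<Rightarrow> ennreal"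
  assumes "finite A" "I \<noteq> {}"
    and "\<And>i j. i \<in> I \<Longrightarrow> j \<in> I \<Longrightarrow> \<exists>k\<in>I. \<forall>a\<in>A. f i a \<le> f k a \<and> f j a \<le> f k a"
  shows "(SUP i\<in>I. \<Sum>a\<in>A. f i a) = (\<Sum>a\<in>A. SUP i\<in>I. f i a)"
  using assms(1,3)
proof (induction A rule: finite_induct)
  case empty
  then show ?case using assms(2) by simp
next
  case (insert x F)
  have "(SUP i\<in>I. f i x + (\<Sum>a\<in>F. f i a)) = (SUP i\<in>I. f i x) + (SUP i\<in>I. \<Sum>a\<in>F. f i a)"
  proof (rule SUP_add_directed_ennreal)
    fix i j assume "i \<in> I" "j \<in> I"
    then obtain k where "k \<in> I" "\<forall>a\<in>insert x F. f i a \<le> f k a \<and> f j a \<le> f k a"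
      using insert.prems by blast
    then show "\<exists>k\<in>I. f i x + (\<Sum>a\<in>F. f j a) \<le> f k x + (\<Sum>a\<in>F. f k a)"
      by (intro bexI[of _ k] add_mono sum_mono) auto
  qed
  moreover have "(SUP i\<in>I. \<Sum>a\<in>F. f i a) = (\<Sum>a\<in>F. SUP i\<in>I. f i a)"
    using insert.prems by (intro insert.IH) (metis insertCI)
  ultimately show ?case using insert by simp
qed

text \<open>Testing with \<open>closure Q \<subseteq> V\<close> rather than
  \<open>Q \<subseteq> V\<close> excludes mass that \<open>c\<close> ascribes to \<open>Q\<close>
  but that sits on the frontier of \<open>Q\<close> outside \<open>V\<close>. In a compact space it
  also makes the tested closures compact, which gives countable subadditivity.\<close>

definition content_inner :: "('a::topological_space set \<Rightarrow> real) \<Rightarrow> 'a set \<Rightarrow> ennreal" where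
  "content_inner c V = (SUP Q\<in>{Q. regular_open Q \<and> closure Q \<subseteq> V}. ennreal (c Q))"

definition content_outer :: "('a::topological_space set \<Rightarrow> real) \<Rightarrow> 'a set \<Rightarrow> ennreal" where
  "content_outer c A = (INF V\<in>{V. open V \<and> A \<subseteq> V}. content_inner c V)"

definition content_measure :: "('a::topological_space set \<Rightarrow> real) \<Rightarrow> 'a measure" where
  "content_measure c = measure_of UNIV (sets borel) (content_outer c)"

lemma content_inner_mono: "V \<subseteq> W \<Longrightarrow> content_inner c V \<le> content_inner c W"
  unfolding content_inner_def by (intro SUP_subset_mono) auto

lemma content_inner_upper:
  "regular_open Q \<Longrightarrow> closure Q \<subseteq> V \<Longrightarrow> ennreal (c Q) \<le> content_inner c V"
  unfolding content_inner_def by (intro SUP_upper) auto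

lemma content_outer_open: "open V \<Longrightarrow> content_outer c V = content_inner c V"
  unfolding content_outer_def
  by (intro antisym INF_lower INF_greatest) (auto intro: content_inner_mono)

lemma content_outer_mono: "A \<subseteq> B \<Longrightarrow> content_outer c A \<le> content_outer c B"
  unfolding content_outer_def by (intro INF_superset_mono) auto

text \<open>Additivity is phrased as cutting a regular open set by a regular partition, without
  normalisation. This form is inherited by \<open>\<lambda>Q. c (Q \<inter> R)\<close>, so every
  result proved here also holds for restricted contents.\<close>

locale compact_regular_content =
  fixes c :: "'a::t2_space set \<Rightarrow> real"
  assumes compact_space: "compact (UNIV :: 'a set)"
    and nonneg: "regular_open R \<Longrightarrow> 0 \<le> c R"
    and partition_sum: "regular_open Q \<Longrightarrow> regular_partition \<P> \<Longrightarrow> c Q = (\<Sum>P\<in>\<P>. c (Q \<inter> P))"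
begin

lemma restrict:
  assumes "regular_open R"
  shows "compact_regular_content (\<lambda>Q. c (Q \<inter> R))"
proof
  fix Q :: "'a set" and \<P> :: "'a set set" assume "regular_open Q" "regular_partition \<P>"
  then have "c (Q \<inter> R) = (\<Sum>P\<in>\<P>. c (Q \<inter> R \<inter> P))"
    by (intro partition_sum regular_open_Int assms)
  then show "c (Q \<inter> R) = (\<Sum>P\<in>\<P>. c (Q \<inter> P \<inter> R))"
    by (simp add: Int_ac)
qed (use compact_space nonneg regular_open_Int assms in auto)

lemma split: "regular_open Q \<Longrightarrow> regular_open R \<Longrightarrow> c Q = c (Q \<inter> R) + c (Q - closure R)"
proof -
  assume Q: "regular_open Q" and R: "regular_open R"
  \<comment> \<open>The partition is a set, so its two members must be distinct for the sum to have
    two terms.\<close>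
  have "R \<noteq> - closure R" using closure_subset[of R] by (cases "R = {}") auto
  then show ?thesis
    using partition_sum[OF Q regular_partition_complement[OF R]] by (simp add: Diff_eq)
qed

lemma empty [simp]: "c {} = 0"
  using split[of "{}" "{}"] by simp

text \<open>Since \<open>R\<close> is open and disjoint from \<open>Q\<close>, it avoids
  \<open>closure Q\<close> and so fits into the part of \<open>S\<close> left after cutting along
  \<open>Q\<close>.\<close>

lemma superadditive:
  assumes "regular_open Q" "regular_open R" "regular_open S" "Q \<inter> R = {}" "Q \<subseteq> S" "R \<subseteq> S"
  shows "c Q + c R \<le> c S"
proof -
  have mono: "c A \<le> c B" if "regular_open A" "regular_open B" "A \<subseteq> B" for A B
    using split[OF that(2,1)] nonneg[OF regular_open_Diff_closure[OF that(2,1)]] that(3)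
    by (simp add: Int_absorb1)
  have "R \<inter> closure Q = {}"
    using assms by (intro regular_open_disjoint_closure) auto
  then have "c R \<le> c (S - closure Q)"
    using assms by (intro mono regular_open_Diff_closure) auto
  then show ?thesis
    using split[OF assms(3,1)] assms by (simp add: Int_absorb1)
qed

lemma mono: "regular_open Q \<Longrightarrow> regular_open R \<Longrightarrow> Q \<subseteq> R \<Longrightarrow> c Q \<le> c R"
  using superadditive[of Q "{}" R] by simp

text \<open>Cutting \<open>S\<close> along \<open>Q\<close> leaves off \<open>closure Q\<close> only
  points of \<open>R\<close>.\<close>

lemma subadditive:
  assumes "regular_open Q" "regular_open R" "regular_open S" "S \<subseteq> Q \<union> R"
  shows "c S \<le> c Q + c R"
proof -
  have "S - closure Q \<subseteq> R" using assms(4) closure_subset[of Q] by auto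
  then have "c (S - closure Q) \<le> c R"
    using assms by (intro mono regular_open_Diff_closure)
  moreover have "c (S \<inter> Q) \<le> c Q"
    using assms by (intro mono regular_open_Int) auto
  ultimately show ?thesis using split[OF assms(3,1)] by linarith
qed

section \<open>Subadditivity of the inner content\<close>

lemma content_inner_empty: "content_inner c {} = 0"
proof -
  have "{Q. regular_open Q \<and> closure Q \<subseteq> {}} = {{} :: 'a set}" by auto
  then show ?thesis by (simp add: content_inner_def)
qed

text \<open>Normality shrinks the cover of a tested \<open>closure Q\<close> twice: \<open>R\<close>
  takes the closed part outside \<open>W\<close>, then \<open>S\<close> takes the closed part
  outside \<open>R\<close>. Both are again tested sets, and they cover \<open>Q\<close>.\<close>

lemma content_inner_Un:
  assumes "open V" "open W"
  shows "content_inner c (V \<union> W) \<le> content_inner c V + content_inner c W"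
  unfolding content_inner_def[of c "V \<union> W"]
proof (rule SUP_least, clarsimp)
  fix Q assume Q: "regular_open Q" "closure Q \<subseteq> V \<union> W"
  have "closed (closure Q - W)" "closure Q - W \<subseteq> V"
    using assms Q by auto
  then obtain R where R: "regular_open R" "closure Q - W \<subseteq> R" "closure R \<subseteq> V"
    by (rule regular_open_between[OF compact_space _ assms(1)])
  have "closed (closure Q - R)" "closure Q - R \<subseteq> W"
    using R regular_open_imp_open by auto
  then obtain S where S: "regular_open S" "closure Q - R \<subseteq> S" "closure S \<subseteq> W"
    by (rule regular_open_between[OF compact_space _ assms(2)])
  have "c Q \<le> c R + c S"
    using Q R S closure_subset[of Q] by (intro subadditive) auto
  then have "ennreal (c Q) \<le> ennreal (c R) + ennreal (c S)"
    using nonneg[OF R(1)] nonneg[OF S(1)] by (simp flip: ennreal_plus add: ennreal_leI)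
  also have "\<dots> \<le> content_inner c V + content_inner c W"
    using R S by (intro add_mono content_inner_upper)
  finally show "ennreal (c Q) \<le> content_inner c V + content_inner c W" .
qed

text \<open>The closure of a tested \<open>Q\<close> is compact, hence covered by finitely many
  \<open>V n\<close>, to which \<open>content_inner_Un\<close> applies repeatedly.\<close>

lemma content_inner_UN:
  assumes "\<And>n::nat. open (V n)"
  shows "content_inner c (\<Union>n. V n) \<le> (\<Sum>n. content_inner c (V n))"
  unfolding content_inner_def[of c "\<Union>n. V n"]
proof (rule SUP_least, clarsimp)
  fix Q assume Q: "regular_open Q" "closure Q \<subseteq> (\<Union>n. V n)"
  have "compact (closure Q)"
    using compact_space compact_Int_closed[of UNIV "closure Q"] by simp
  then obtain F where F: "finite F" "closure Q \<subseteq> (\<Union>n\<in>F. V n)"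
    using compactE_image[of "closure Q" UNIV V] assms Q by metis
  have fin: "content_inner c (\<Union>n\<in>G. V n) \<le> (\<Sum>n\<in>G. content_inner c (V n))" if "finite G" for G
    using that
  proof (induction rule: finite_induct)
    case (insert x G)
    have "content_inner c (V x \<union> (\<Union>n\<in>G. V n)) \<le> content_inner c (V x) + content_inner c (\<Union>n\<in>G. V n)"
      using assms by (intro content_inner_Un) auto
    with insert show ?case by (auto intro: order_trans add_left_mono)
  qed (simp add: content_inner_empty)
  have "ennreal (c Q) \<le> content_inner c (\<Union>n\<in>F. V n)"
    using Q F by (intro content_inner_upper)
  also note fin[OF F(1)]
  also have "(\<Sum>n\<in>F. content_inner c (V n)) \<le> (\<Sum>n. content_inner c (V n))"
    using F by (intro sum_le_suminf) auto
  finally show "ennreal (c Q) \<le> (\<Sum>n. content_inner c (V n))" .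
qed

section \<open>The outer measure and Caratheodory's condition for open sets\<close>

lemma content_outer_close:
  "content_outer c A < e \<Longrightarrow> \<exists>V. open V \<and> A \<subseteq> V \<and> content_inner c V < e"
  unfolding content_outer_def INF_less_iff by auto

lemma countably_subadditive_content_outer: "countably_subadditive (Pow UNIV) (content_outer c)"
  unfolding countably_subadditive_def
proof (intro allI impI)
  fix A :: "nat \<Rightarrow> 'a set"
  show "content_outer c (\<Union>i. A i) \<le> (\<Sum>n. content_outer c (A n))"
  proof (rule ennreal_le_epsilon)
    fix e :: real assume "0 < e" "(\<Sum>n. content_outer c (A n)) < top"
    \<comment> \<open>A finite sum has finite terms, so adding \<open>e * (1/2)^Suc n\<close> is a
      strict increase; these errors add up to \<open>e\<close>.\<close>
    then have *: "\<And>n. content_outer c (A n) < content_outer c (A n) + e * (1/2)^Suc n"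
      by (auto simp add: less_top dest!: ennreal_suminf_lessD)
    obtain V where V: "\<And>n. open (V n)" "\<And>n. A n \<subseteq> V n"
        and le: "\<And>n. content_inner c (V n) \<le> content_outer c (A n) + e * (1/2)^Suc n"
      by (metis less_imp_le content_outer_close[OF *])
    have "content_outer c (\<Union>i. A i) \<le> content_inner c (\<Union>i. V i)"
      unfolding content_outer_def using V by (intro INF_lower) auto
    also have "\<dots> \<le> (\<Sum>n. content_inner c (V n))"
      using V by (intro content_inner_UN)
    also have "\<dots> \<le> (\<Sum>n. content_outer c (A n) + e * (1/2) ^ Suc n)"
      by (intro suminf_le allI le) auto
    also have "\<dots> = (\<Sum>n. content_outer c (A n)) + (\<Sum>n. ennreal e * ennreal ((1/2) ^ Suc n))"
      using \<open>0 < e\<close> by (subst suminf_add[symmetric])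
                       (auto simp del: ennreal_suminf_cmult simp add: ennreal_mult[symmetric])
    also have "\<dots> = (\<Sum>n. content_outer c (A n)) + e"
      unfolding ennreal_suminf_cmult
      by (subst suminf_ennreal_eq[OF zero_le_power power_half_series]) auto
    finally show "content_outer c (\<Union>i. A i) \<le> (\<Sum>n. content_outer c (A n)) + e" .
  qed
qed

lemma outer_measure_space_content_outer: "outer_measure_space (Pow UNIV) (content_outer c)"
  unfolding outer_measure_space_def positive_def increasing_def
  using countably_subadditive_content_outer
  by (auto simp: content_outer_open content_inner_empty intro: content_outer_mono)

text \<open>If \<open>Q\<close> is tested in \<open>W \<inter> V\<close>, then
  \<open>W - closure Q\<close> is open and contains \<open>W - V\<close>. Any \<open>R\<close>
  tested there is disjoint from \<open>Q\<close>, and the join of \<open>Q\<close> and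
  \<open>R\<close> is tested in \<open>W\<close>, so superadditivity applies.\<close>

lemma content_inner_split:
  assumes "open V" "open W"
  shows "content_inner c (W \<inter> V) + content_outer c (W - V) \<le> content_inner c W"
proof -
  have "ennreal (c Q) + content_outer c (W - V) \<le> content_inner c W"
    if Q: "regular_open Q" "closure Q \<subseteq> W \<inter> V" for Q
  proof -
    have "content_outer c (W - V) \<le> content_inner c (W - closure Q)"
      unfolding content_outer_def using assms Q by (intro INF_lower) auto
    then have "ennreal (c Q) + content_outer c (W - V) \<le> ennreal (c Q) + content_inner c (W - closure Q)"
      by (rule add_left_mono)
    also have "\<dots> \<le> content_inner c W"
      unfolding content_inner_def[of c "W - closure Q"]
    proof (subst ennreal_SUP_add_right)
      show "(SUP R\<in>{R. regular_open R \<and> closure R \<subseteq> W - closure Q}. ennreal (c Q) + ennreal (c R))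
          \<le> content_inner c W"
      proof (rule SUP_least, clarsimp)
        fix R assume R: "regular_open R" "closure R \<subseteq> W - closure Q"
        define S where "S = interior (closure (Q \<union> R))"
        have regS: "regular_open S" unfolding S_def by (rule regular_open_interior_closure)
        have "Q \<union> R \<subseteq> S"
          unfolding S_def using Q R
          by (intro interior_maximal closure_subset) (auto intro: regular_open_imp_open)
        moreover have "Q \<inter> R = {}" using R closure_subset[of Q] closure_subset[of R] by auto
        ultimately have "c Q + c R \<le> c S"
          using Q R regS by (intro superadditive) auto
        then have "ennreal (c Q) + ennreal (c R) \<le> ennreal (c S)"
          using nonneg[OF Q(1)] nonneg[OF R(1)] by (simp flip: ennreal_plus add: ennreal_leI)
        also have "\<dots> \<le> content_inner c W"
        proof (rule content_inner_upper)
          have "closure S \<subseteq> closure (Q \<union> R)"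
            unfolding S_def by (intro closure_minimal interior_subset closed_closure)
          then show "closure S \<subseteq> W" using Q R by auto
        qed (rule regS)
        finally show "ennreal (c Q) + ennreal (c R) \<le> content_inner c W" .
      qed
      show "{R. regular_open R \<and> closure R \<subseteq> W - closure Q} \<noteq> {}"
        by (auto intro!: exI[of _ "{}"])
    qed
    finally show ?thesis .
  qed
  then show ?thesis
    unfolding content_inner_def[of c "W \<inter> V"]
    by (subst ennreal_SUP_add_left[symmetric]) (auto intro!: exI[of _ "{}"] SUP_least)
qed

text \<open>Subadditivity gives one half for every \<open>A\<close>. For the other, \<open>A\<close>
  is enlarged to an open \<open>W\<close>, where \<open>content_inner_split\<close> applies, and the
  infimum over \<open>W\<close> is taken.\<close>

lemma open_in_lambda_system:
  assumes "open V"
  shows "V \<in> lambda_system UNIV (Pow UNIV) (content_outer c)"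
proof -
  have "content_outer c (A \<inter> V) + content_outer c (A - V) = content_outer c A" for A
  proof (rule antisym)
    show "content_outer c (A \<inter> V) + content_outer c (A - V) \<le> content_outer c A"
      unfolding content_outer_def[of c A]
    proof (rule INF_greatest, clarsimp)
      fix W assume W: "open W" "A \<subseteq> W"
      have "content_outer c (A \<inter> V) + content_outer c (A - V)
          \<le> content_outer c (W \<inter> V) + content_outer c (W - V)"
        using W by (intro add_mono content_outer_mono) auto
      also have "\<dots> \<le> content_inner c W"
        using W assms by (simp add: content_outer_open open_Int content_inner_split)
      finally show "content_outer c (A \<inter> V) + content_outer c (A - V) \<le> content_inner c W" .
    qed
    have "subadditive (Pow UNIV) (content_outer c)"
      using sigma_algebra_Pow[of "UNIV :: 'a set"] outer_measure_space_content_outer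
      by (intro ring_of_sets.countably_subadditive_subadditive)
         (auto simp: outer_measure_space_def sigma_algebra_def algebra_def)
    then have "content_outer c ((A \<inter> V) \<union> (A - V)) \<le> content_outer c (A \<inter> V) + content_outer c (A - V)"
      by (rule subadditiveD) auto
    then show "content_outer c A \<le> content_outer c (A \<inter> V) + content_outer c (A - V)"
      by (simp add: Int_Diff_Un)
  qed
  then show ?thesis
    by (subst algebra.lambda_system_eq[OF algebra_Pow]) auto
qed

section \<open>The Borel measure and its regularity\<close>

lemma sets_content_measure [simp, measurable_cong]: "sets (content_measure c) = sets borel"
  and space_content_measure [simp]: "space (content_measure c) = UNIV"
proof -
  have "sigma_sets UNIV (sets (borel :: 'a measure)) = sets borel"
    using sets.sigma_sets_eq[of "borel :: 'a measure"] by simp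
  then show "sets (content_measure c) = sets borel" "space (content_measure c) = UNIV"
    by (simp_all add: content_measure_def)
qed

text \<open>By Caratheodory's lemma the lambda system is a sigma-algebra on which the outer measure
  is a measure; it contains the open sets and hence all Borel sets.\<close>

lemma emeasure_content_measure:
  assumes "B \<in> sets borel"
  shows "emeasure (content_measure c) B = content_outer c B"
proof -
  let ?L = "lambda_system UNIV (Pow UNIV) (content_outer c)"
  have ms: "measure_space UNIV ?L (content_outer c)"
    using sigma_algebra.caratheodory_lemma[OF sigma_algebra_Pow outer_measure_space_content_outer] .
  then interpret sigma_algebra UNIV ?L by (simp add: measure_space_def)
  have sub: "sets borel \<subseteq> ?L"
  proof -
    have "sets (borel :: 'a measure) = sigma_sets UNIV {S. open S}"
      unfolding borel_def by (rule sets_measure_of) auto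
    then show ?thesis
      using open_in_lambda_system sigma_sets_subset[of "{S. open S}"] by simp blast
  qed
  have "countably_additive (sets borel) (content_outer c)"
    using ms sub unfolding measure_space_def countably_additive_def by blast
  moreover have "positive (sets borel) (content_outer c)"
    by (simp add: positive_def content_outer_open content_inner_empty)
  ultimately show ?thesis
    unfolding content_measure_def
    using sets.sigma_algebra_axioms[of borel] assms by (intro emeasure_measure_of_sigma) auto
qed

lemma emeasure_content_measure_open:
  "open V \<Longrightarrow> emeasure (content_measure c) V = content_inner c V"
  by (simp add: emeasure_content_measure content_outer_open)

lemma emeasure_content_measure_UNIV: "emeasure (content_measure c) UNIV = ennreal (c UNIV)"
proof -
  have "content_inner c UNIV = ennreal (c UNIV)"
    unfolding content_inner_def
    by (intro antisym SUP_least SUP_upper ennreal_leI mono) auto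
  then show ?thesis by (simp add: emeasure_content_measure_open)
qed

lemma finite_measure_content_measure: "finite_measure (content_measure c)"
  by (rule finite_measureI) (simp add: emeasure_content_measure_UNIV)

lemma content_measure_outer_regular:
  assumes "B \<in> sets borel"
  shows "emeasure (content_measure c) B = (INF V\<in>{V. open V \<and> B \<subseteq> V}. emeasure (content_measure c) V)"
  unfolding emeasure_content_measure[OF assms] content_outer_def[of c B]
  by (intro INF_cong) (auto simp: emeasure_content_measure_open)

text \<open>Inner regularity is outer regularity of the complement: if an open \<open>V\<close>
  contains \<open>- B\<close> with excess at most \<open>e\<close>, then the closed set
  \<open>- V\<close> lies in \<open>B\<close> and misses only \<open>B \<inter> V\<close>, of
  measure at most \<open>e\<close>. Finiteness permits the cancellation.\<close>

lemma normal_measure_content_measure: "normal_measure (content_measure c)"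
proof -
  interpret finite_measure "content_measure c" by (rule finite_measure_content_measure)
  let ?\<nu> = "content_measure c"
  have "emeasure ?\<nu> B = (SUP C\<in>{C. closed C \<and> C \<subseteq> B}. emeasure ?\<nu> C)" if B: "B \<in> sets borel" for B
  proof (rule antisym)
    show "emeasure ?\<nu> B \<le> (SUP C\<in>{C. closed C \<and> C \<subseteq> B}. emeasure ?\<nu> C)"
    proof (rule ennreal_le_epsilon)
      fix e :: real assume e: "0 < e"
      have "- B \<in> sets borel" using B by (rule borel_comp)
      have "emeasure ?\<nu> (- B) < emeasure ?\<nu> (- B) + e"
        using e by (simp add: ennreal_less_top less_top[symmetric])
      then obtain V where V: "open V" "- B \<subseteq> V" "emeasure ?\<nu> V < emeasure ?\<nu> (- B) + e"
        unfolding content_measure_outer_regular[OF \<open>- B \<in> sets borel\<close>] INF_less_iff by auto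
      have "emeasure ?\<nu> (-B) + emeasure ?\<nu> (B \<inter> V) = emeasure ?\<nu> V"
        using V B by (subst plus_emeasure) (auto intro!: arg_cong[where f="emeasure ?\<nu>"])
      then have "emeasure ?\<nu> (B \<inter> V) \<le> e"
        using V(3) by (metis ennreal_add_left_cancel_le emeasure_finite less_imp_le infinity_ennreal_def)
      have "emeasure ?\<nu> B = emeasure ?\<nu> (- V) + emeasure ?\<nu> (B \<inter> V)"
        using V B by (subst plus_emeasure) (auto intro!: arg_cong[where f="emeasure ?\<nu>"])
      also have "\<dots> \<le> (SUP C\<in>{C. closed C \<and> C \<subseteq> B}. emeasure ?\<nu> C) + e"
        using V \<open>emeasure ?\<nu> (B \<inter> V) \<le> e\<close> by (intro add_mono SUP_upper) auto
      finally show "emeasure ?\<nu> B \<le> (SUP C\<in>{C. closed C \<and> C \<subseteq> B}. emeasure ?\<nu> C) + e" .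
    qed
  qed (use B in \<open>auto intro!: SUP_least emeasure_mono\<close>)
  then show ?thesis
    using content_measure_outer_regular unfolding normal_measure_def by auto
qed

end

subsection \<open>Densities of restricted contents\<close>

text \<open>Domination forces the Radon-Nikodym derivative to be at most 1 almost everywhere, so
  capping it at 1 gives a density of the same measure.\<close>

lemma dominated_finite_measure_density:
  assumes M: "finite_measure M" and sets: "sets N = sets M"
    and le: "\<And>A. A \<in> sets M \<Longrightarrow> emeasure N A \<le> emeasure M A"
  shows "N = density M (\<lambda>x. ennreal (enn2real (min 1 (RN_deriv M N x))))"
proof -
  interpret finite_measure M by fact
  let ?f = "RN_deriv M N"
  have "absolutely_continuous M N"
    unfolding absolutely_continuous_def null_sets_def using le sets by fastforce
  then have N: "density M ?f = N" using sets by (rule density_RN_deriv)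
  \<comment> \<open>Over the set where the derivative exceeds 1, the integral of its excess is
    \<open>emeasure N A - emeasure M A\<close>, which domination makes 0; so the excess vanishes
    almost everywhere.\<close>
  define A where "A = {x \<in> space M. 1 < ?f x}"
  have [measurable]: "A \<in> sets M" by (simp add: A_def)
  have "emeasure (density M ?f) A = (\<integral>\<^sup>+x. ?f x * indicator A x \<partial>M)"
    by (rule emeasure_density) auto
  then have fA: "(\<integral>\<^sup>+x. ?f x * indicator A x \<partial>M) = emeasure N A"
    by (simp only: N)
  have "(\<integral>\<^sup>+x. ?f x * indicator A x - indicator A x \<partial>M) = emeasure N A - emeasure M A"
  proof (subst nn_integral_diff)
    show "AE x in M. indicator A x \<le> ?f x * indicator A x"
      by (intro AE_I2) (auto simp: A_def indicator_def)
  qed (simp_all add: fA)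
  moreover have "emeasure N A < top"
    by (rule le_less_trans[OF le]) (simp_all add: less_top[symmetric])
  ultimately have "(\<integral>\<^sup>+x. ?f x * indicator A x - indicator A x \<partial>M) = 0"
    using le[of A] by (simp add: diff_eq_0_iff_ennreal)
  then have "AE x in M. ?f x * indicator A x - indicator A x = 0"
    by (subst (asm) nn_integral_0_iff_AE) auto
  then have "AE x in M. ?f x \<le> 1"
    using AE_space
  proof eventually_elim
    case (elim x)
    then show ?case
      by (cases "1 < ?f x") (auto simp: A_def diff_eq_0_iff_ennreal)
  qed
  then have "AE x in M. ?f x = ennreal (enn2real (min 1 (?f x)))"
    by eventually_elim (metis ennreal_enn2real ennreal_one_less_top le_less_trans min.absorb2)
  then have "density M ?f = density M (\<lambda>x. ennreal (enn2real (min 1 (?f x))))"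
    by (intro density_cong) auto
  then show ?thesis by (simp add: N)
qed

text \<open>The cap makes the bounds 0 and 1 hold at every point and not just almost everywhere, as
  \<open>liminal_density_structure\<close> demands on the frontier.\<close>

definition content_density :: "('a::t2_space set \<Rightarrow> real) \<Rightarrow> 'a set \<Rightarrow> 'a \<Rightarrow> real" where
  "content_density c R x =
     enn2real (min 1 (RN_deriv (content_measure c) (content_measure (\<lambda>Q. c (Q \<inter> R))) x))"

lemma content_density_nonneg [simp]: "0 \<le> content_density c R x"
  by (simp add: content_density_def)

lemma content_density_le_1 [simp]: "content_density c R x \<le> 1"
  unfolding content_density_def by (intro enn2real_leI) auto

section \<open>Additivity of the measures and densities over a regular partition\<close>

context compact_regular_content
begin

lemma borel_measurable_content_density [measurable]: "content_density c R \<in> borel_measurable borel"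
proof -
  have "content_density c R \<in> borel_measurable (content_measure c)"
    unfolding content_density_def by measurable
  then show ?thesis by simp
qed

text \<open>The sum over cells commutes with the supremum because the sets tested in
  \<open>V\<close> are directed: the join of two of them is tested again and dominates both on every
  cell.\<close>

lemma content_measure_partition_open:
  assumes "regular_partition \<P>" "open V"
  shows "emeasure (content_measure c) V = (\<Sum>P\<in>\<P>. emeasure (content_measure (\<lambda>Q. c (Q \<inter> P))) V)"
proof -
  let ?I = "{Q. regular_open Q \<and> closure Q \<subseteq> V}"
  have reg: "regular_open P" if "P \<in> \<P>" for P
    using assms(1) that by (rule regular_partition_regular)
  have "content_inner c V = (SUP Q\<in>?I. \<Sum>P\<in>\<P>. ennreal (c (Q \<inter> P)))"
    unfolding content_inner_def
    by (intro SUP_cong refl)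
       (subst partition_sum[OF _ assms(1)], auto simp: reg nonneg regular_open_Int sum_ennreal)
  also have "\<dots> = (\<Sum>P\<in>\<P>. SUP Q\<in>?I. ennreal (c (Q \<inter> P)))"
  proof (rule SUP_sum_directed_ennreal)
    fix Q R assume Q: "Q \<in> ?I" and R: "R \<in> ?I"
    define S where "S = interior (closure (Q \<union> R))"
    have S: "regular_open S"
      unfolding S_def by (rule regular_open_interior_closure)
    have "closure S \<subseteq> closure (Q \<union> R)"
      unfolding S_def by (intro closure_minimal interior_subset closed_closure)
    then have "S \<in> ?I" using Q R S by auto
    moreover have "Q \<union> R \<subseteq> S"
      unfolding S_def using Q R
      by (intro interior_maximal closure_subset) (auto intro: regular_open_imp_open)
    then have "\<forall>P\<in>\<P>. ennreal (c (Q \<inter> P)) \<le> ennreal (c (S \<inter> P)) \<and> ennreal (c (R \<inter> P)) \<le> ennreal (c (S \<inter> P))"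
      using Q R S reg by (auto intro!: ennreal_leI mono regular_open_Int)
    ultimately show "\<exists>S\<in>?I. \<forall>P\<in>\<P>. ennreal (c (Q \<inter> P)) \<le> ennreal (c (S \<inter> P)) \<and> ennreal (c (R \<inter> P)) \<le> ennreal (c (S \<inter> P))"
      by blast
  next
    show "?I \<noteq> {}" by (auto intro!: exI[of _ "{}"])
  qed (rule regular_partition_finite[OF assms(1)])
  also have "\<dots> = (\<Sum>P\<in>\<P>. emeasure (content_measure (\<lambda>Q. c (Q \<inter> P))) V)"
    using assms(2)
    by (intro sum.cong refl)
       (simp add: compact_regular_content.emeasure_content_measure_open[OF restrict[OF reg]] content_inner_def)
  finally show ?thesis by (simp add: emeasure_content_measure_open assms(2))
qed

text \<open>Agreement on open sets spreads by the pi-lambda argument, as they generate the Borel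
  sets and are closed under intersection. Real-valued \<open>measure\<close> keeps the subtraction
  for complements harmless.\<close>

lemma content_measure_partition:
  assumes \<P>: "regular_partition \<P>" and "B \<in> sets borel"
  shows "emeasure (content_measure c) B = (\<Sum>P\<in>\<P>. emeasure (content_measure (\<lambda>Q. c (Q \<inter> P))) B)"
proof -
  define N where "N P = content_measure (\<lambda>Q. c (Q \<inter> P))" for P
  have crc: "compact_regular_content (\<lambda>Q. c (Q \<inter> P))" if "P \<in> \<P>" for P
    using \<P> that by (intro restrict regular_partition_regular)
  interpret C: finite_measure "content_measure c" by (rule finite_measure_content_measure)
  have fin: "finite_measure (N P)" if "P \<in> \<P>" for P
    unfolding N_def by (rule compact_regular_content.finite_measure_content_measure[OF crc[OF that]])
  have sets: "sets (N P) = sets borel" "space (N P) = UNIV" if "P \<in> \<P>" for P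
    unfolding N_def using crc[OF that]
    by (rule compact_regular_content.sets_content_measure compact_regular_content.space_content_measure)+
  have em: "emeasure (N P) A = ennreal (measure (N P) A)" if "P \<in> \<P>" for P A
    using fin[OF that] by (rule finite_measure.emeasure_eq_measure)
  have borel: "sets borel = sigma_sets UNIV {S :: 'a set. open S}"
    unfolding borel_def by (rule sets_measure_of) auto
  have opn: "measure (content_measure c) V = (\<Sum>P\<in>\<P>. measure (N P) V)" if "open V" for V
  proof -
    have "ennreal (measure (content_measure c) V) = (\<Sum>P\<in>\<P>. ennreal (measure (N P) V))"
      using content_measure_partition_open[OF \<P> that]
      by (simp add: C.emeasure_eq_measure em flip: N_def)
    then show ?thesis by (simp add: sum_ennreal sum_nonneg)
  qed
  have "Int_stable {S :: 'a set. open S}" "{S :: 'a set. open S} \<subseteq> Pow UNIV"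
      "B \<in> sigma_sets UNIV {S. open S}"
    using assms(2) borel by (auto simp: Int_stable_def)
  then have "measure (content_measure c) B = (\<Sum>P\<in>\<P>. measure (N P) B)"
  proof (induction rule: sigma_sets_induct_disjoint)
    case (compl A)
    then have A: "A \<in> sets borel" by (simp add: borel)
    have "measure (content_measure c) (UNIV - A) = measure (content_measure c) UNIV - measure (content_measure c) A"
      using C.finite_measure_compl[of A] A by simp
    also have "\<dots> = (\<Sum>P\<in>\<P>. measure (N P) UNIV - measure (N P) A)"
      by (simp add: opn compl sum_subtractf)
    also have "\<dots> = (\<Sum>P\<in>\<P>. measure (N P) (UNIV - A))"
      using finite_measure.finite_measure_compl[OF fin] A by (intro sum.cong) (auto simp: sets)
    finally show ?case .
  next
    case (union A)
    then have A: "range A \<subseteq> sets borel" by (auto simp: borel)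
    have "(\<lambda>i. measure (content_measure c) (A i)) sums measure (content_measure c) (\<Union>i. A i)"
      using A union by (intro C.finite_measure_UNION) auto
    moreover have "(\<lambda>i. \<Sum>P\<in>\<P>. measure (N P) (A i)) sums (\<Sum>P\<in>\<P>. measure (N P) (\<Union>i. A i))"
      using A union by (intro sums_sum finite_measure.finite_measure_UNION[OF fin]) (auto simp: sets)
    ultimately show ?case
      using union sums_unique2 by force
  qed (auto simp: opn)
  then show ?thesis
    by (simp add: C.emeasure_eq_measure em sum_ennreal flip: N_def)
qed

text \<open>Domination holds because the restricted measure is one summand of the decomposition
  along \<open>{R, - closure R}\<close>.\<close>

lemma content_measure_restrict_density:
  assumes "regular_open R"
  shows "content_measure (\<lambda>Q. c (Q \<inter> R)) = density (content_measure c) (\<lambda>x. ennreal (content_density c R x))"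
  unfolding content_density_def
proof (rule dominated_finite_measure_density[OF finite_measure_content_measure])
  show "sets (content_measure (\<lambda>Q. c (Q \<inter> R))) = sets (content_measure c)"
    by (simp add: compact_regular_content.sets_content_measure[OF restrict[OF assms]])
  fix A assume "A \<in> sets (content_measure c)"
  then have "A \<in> sets borel" by simp
  then show "emeasure (content_measure (\<lambda>Q. c (Q \<inter> R))) A \<le> emeasure (content_measure c) A"
    unfolding content_measure_partition[OF regular_partition_complement[OF assms] \<open>A \<in> sets borel\<close>]
    by (intro member_le_sum) auto
qed

text \<open>The sum of the densities and the constant 1 are both densities of
  \<open>content_measure c\<close> with respect to itself, so they agree almost everywhere.\<close>

lemma content_density_partition:
  assumes \<P>: "regular_partition \<P>"
  shows "AE x in content_measure c. (\<Sum>P\<in>\<P>. content_density c P x) = 1"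
proof -
  interpret finite_measure "content_measure c" by (rule finite_measure_content_measure)
  have "density (content_measure c) (\<lambda>x. \<Sum>P\<in>\<P>. ennreal (content_density c P x)) = density (content_measure c) (\<lambda>_. 1)"
  proof (rule measure_eqI)
    fix B assume "B \<in> sets (density (content_measure c) (\<lambda>x. \<Sum>P\<in>\<P>. ennreal (content_density c P x)))"
    then have [measurable]: "B \<in> sets borel" by simp
    have "emeasure (density (content_measure c) (\<lambda>x. \<Sum>P\<in>\<P>. ennreal (content_density c P x))) B
        = (\<Sum>P\<in>\<P>. \<integral>\<^sup>+x. ennreal (content_density c P x) * indicator B x \<partial>content_measure c)"
      by (simp add: emeasure_density sum_distrib_right nn_integral_sum del: sum_ennreal)
    also have "\<dots> = (\<Sum>P\<in>\<P>. emeasure (content_measure (\<lambda>Q. c (Q \<inter> P))) B)"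
      using regular_partition_regular[OF \<P>]
      by (intro sum.cong refl) (simp add: content_measure_restrict_density emeasure_density)
    also have "\<dots> = emeasure (density (content_measure c) (\<lambda>_. 1)) B"
      by (simp add: content_measure_partition[OF \<P>] density_1)
    finally show "emeasure (density (content_measure c) (\<lambda>x. \<Sum>P\<in>\<P>. ennreal (content_density c P x))) B
        = emeasure (density (content_measure c) (\<lambda>_. 1)) B" .
  qed simp
  then have "AE x in content_measure c. (\<Sum>P\<in>\<P>. ennreal (content_density c P x)) = 1"
    by (intro density_unique) auto
  then show ?thesis
    by eventually_elim (simp add: sum_ennreal)
qed

section \<open>Values of the densities away from the frontier\<close>

lemma content_measure_restrict_closure:
  assumes "regular_open R"
  shows "AE x in content_measure (\<lambda>Q. c (Q \<inter> R)). x \<in> closure R"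
proof -
  interpret R: compact_regular_content "\<lambda>Q. c (Q \<inter> R)" using assms by (rule restrict)
  \<comment> \<open>A set tested in the complement of \<open>closure R\<close> misses
    \<open>R\<close>, so its restricted content is that of the empty set.\<close>
  have "content_inner (\<lambda>Q. c (Q \<inter> R)) (- closure R) \<le> 0"
    unfolding content_inner_def
  proof (rule SUP_least)
    fix Q assume "Q \<in> {Q. regular_open Q \<and> closure Q \<subseteq> - closure R}"
    then have "Q \<inter> R = {}" using closure_subset[of Q] closure_subset[of R] by blast
    then show "ennreal (c (Q \<inter> R)) \<le> 0" by simp
  qed
  then have "emeasure (content_measure (\<lambda>Q. c (Q \<inter> R))) (- closure R) = 0"
    by (subst R.emeasure_content_measure_open) auto
  then show ?thesis
    by (intro AE_I[where N="- closure R"]) auto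
qed

lemma content_density_outside:
  assumes "regular_open R"
  shows "AE x in content_measure c. x \<notin> closure R \<longrightarrow> content_density c R x = 0"
proof -
  have "AE x in content_measure c. 0 < ennreal (content_density c R x) \<longrightarrow> x \<in> closure R"
    using content_measure_restrict_closure[OF assms]
    unfolding content_measure_restrict_density[OF assms] by (subst (asm) AE_density) auto
  then show ?thesis
    by eventually_elim (use content_density_nonneg[of c R] in \<open>force simp: less_le\<close>)
qed

text \<open>The densities of \<open>R\<close> and \<open>- closure R\<close> add up to 1, and the
  second vanishes on \<open>R\<close> because \<open>R\<close> is disjoint from the closure of
  \<open>- closure R\<close>.\<close>

lemma content_density_inside:
  assumes "regular_open R"
  shows "AE x in content_measure c. x \<in> R \<longrightarrow> content_density c R x = 1"
proof -
  have "R \<noteq> - closure R" using closure_subset[of R] by (cases "R = {}") auto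
  then have "AE x in content_measure c. content_density c R x + content_density c (- closure R) x = 1"
    using content_density_partition[OF regular_partition_complement[OF assms]] by simp
  with content_density_outside[OF regular_open_Compl_closure[OF assms]]
  show ?thesis
  proof eventually_elim
    case (elim x)
    have "R \<inter> closure (- closure R) = {}"
      using closure_subset[of R] assms by (intro regular_open_disjoint_closure) auto
    with elim show ?case by auto
  qed
qed

section \<open>Integrals of continuous functions\<close>

lemma integral_content_measure_restrict:
  fixes f :: "'a \<Rightarrow> real"
  assumes "regular_open R" and [measurable]: "f \<in> borel_measurable borel"
  shows "(LINT x|content_measure (\<lambda>Q. c (Q \<inter> R)). f x) = (LINT x|content_measure c. content_density c R x * f x)"
  unfolding content_measure_restrict_density[OF assms(1)]
  by (subst integral_density) auto

lemma continuous_imp_borel_bounded: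
  fixes f :: "'a \<Rightarrow> real"
  assumes "continuous_on UNIV f"
  shows "f \<in> borel_measurable borel" "bounded (range f)"
  using assms compact_space
  by (auto intro: borel_measurable_continuous_onI compact_imp_bounded compact_continuous_image)

lemma integrable_content_measure:
  fixes f :: "'a \<Rightarrow> real"
  assumes "f \<in> borel_measurable borel" "bounded (range f)"
  shows "integrable (content_measure c) f"
proof -
  interpret finite_measure "content_measure c" by (rule finite_measure_content_measure)
  obtain B where "\<And>x. norm (f x) \<le> B"
    using assms(2) by (auto simp: bounded_iff)
  then show ?thesis using assms(1) by (intro integrable_const_bound) auto
qed

text \<open>Each cell integral becomes an integral against \<open>content_measure c\<close> weighted
  by the cell's density, and the weights add up to 1.\<close>

lemma integral_content_measure_partition:
  fixes f :: "'a \<Rightarrow> real"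
  assumes \<P>: "regular_partition \<P>" and f: "continuous_on UNIV f"
  shows "(LINT x|content_measure c. f x) = (\<Sum>P\<in>\<P>. LINT x|content_measure (\<lambda>Q. c (Q \<inter> P)). f x)"
proof -
  note [measurable] = continuous_imp_borel_bounded(1)[OF f]
  have int: "integrable (content_measure c) (\<lambda>x. content_density c P x * f x)" for P
  proof (rule integrable_content_measure)
    obtain B where "\<And>x. norm (f x) \<le> B"
      using continuous_imp_borel_bounded(2)[OF f] by (auto simp: bounded_iff)
    then have "norm (content_density c P x * f x) \<le> 1 * B" for x
      unfolding norm_mult by (intro mult_mono) auto
    then show "bounded (range (\<lambda>x. content_density c P x * f x))"
      unfolding bounded_iff by blast
  qed simp
  have "(\<Sum>P\<in>\<P>. LINT x|content_measure (\<lambda>Q. c (Q \<inter> P)). f x)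
      = (\<Sum>P\<in>\<P>. LINT x|content_measure c. content_density c P x * f x)"
    using regular_partition_regular[OF \<P>] by (intro sum.cong refl integral_content_measure_restrict) auto
  also have "\<dots> = (LINT x|content_measure c. (\<Sum>P\<in>\<P>. content_density c P x) * f x)"
    by (simp add: sum_distrib_right Bochner_Integration.integral_sum int)
  also have "\<dots> = (LINT x|content_measure c. f x)"
    using content_density_partition[OF \<P>]
    by (intro integral_cong_AE) (auto elim: eventually_mono)
  finally show ?thesis by simp
qed

text \<open>A bound on \<open>R\<close> extends by continuity to \<open>closure R\<close>, which
  carries the restricted measure, whose total mass is \<open>c R\<close>.\<close>

lemma integral_restrict_bounds:
  fixes f :: "'a \<Rightarrow> real"
  assumes R: "regular_open R" and f: "continuous_on UNIV f"
  shows "(\<And>x. x \<in> R \<Longrightarrow> r \<le> f x) \<Longrightarrow> r * c R \<le> (LINT x|content_measure (\<lambda>Q. c (Q \<inter> R)). f x)"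
    and "(\<And>x. x \<in> R \<Longrightarrow> f x \<le> r) \<Longrightarrow> (LINT x|content_measure (\<lambda>Q. c (Q \<inter> R)). f x) \<le> r * c R"
proof -
  interpret R: compact_regular_content "\<lambda>Q. c (Q \<inter> R)" using R by (rule restrict)
  interpret finite_measure "content_measure (\<lambda>Q. c (Q \<inter> R))" by (rule R.finite_measure_content_measure)
  have int: "integrable (content_measure (\<lambda>Q. c (Q \<inter> R))) f"
    using continuous_imp_borel_bounded[OF f] by (rule R.integrable_content_measure)
  have "measure (content_measure (\<lambda>Q. c (Q \<inter> R))) UNIV = c R"
    using R.emeasure_content_measure_UNIV nonneg[OF R] by (simp add: measure_def)
  then have const: "(LINT x|content_measure (\<lambda>Q. c (Q \<inter> R)). r) = r * c R"
    by simp
  have cont: "continuous_on (closure R) f" using f continuous_on_subset by blast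
  show "r * c R \<le> (LINT x|content_measure (\<lambda>Q. c (Q \<inter> R)). f x)" if "\<And>x. x \<in> R \<Longrightarrow> r \<le> f x"
    unfolding const[symmetric] using content_measure_restrict_closure[OF R]
    by (intro integral_mono_AE int) (auto elim!: eventually_mono dest: continuous_ge_on_closure[OF cont _ that])
  show "(LINT x|content_measure (\<lambda>Q. c (Q \<inter> R)). f x) \<le> r * c R" if "\<And>x. x \<in> R \<Longrightarrow> f x \<le> r"
    unfolding const[symmetric] using content_measure_restrict_closure[OF R]
    by (intro integral_mono_AE int) (auto elim!: eventually_mono dest: continuous_le_on_closure[OF cont _ that])
qed

text \<open>Cell by cell, every admissible simple function integrates to at most \<open>?I\<close>.
  Conversely, a partition on which \<open>g\<close> oscillates little yields an admissible one whose
  integral falls short of \<open>?I\<close> by at most \<open>e * c R\<close>.\<close>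

lemma fint_eq_integral:
  assumes R: "regular_open R" and g: "continuous_on UNIV g"
  shows "fint c R g = (LINT x|content_measure (\<lambda>Q. c (Q \<inter> R)). g x)"
proof -
  interpret R: compact_regular_content "\<lambda>Q. c (Q \<inter> R)" using R by (rule restrict)
  let ?I = "LINT x|content_measure (\<lambda>Q. c (Q \<inter> R)). g x"
  let ?S = "{I. \<exists>f. bounded (range f) \<and> has_simple_fint c R f I \<and> (\<forall>x\<in>R. f x \<le> g x)}"
  have sum: "?I = (\<Sum>P\<in>\<P>. LINT x|content_measure (\<lambda>Q. c (Q \<inter> (P \<inter> R))). g x)"
    if "regular_partition \<P>" for \<P>
    using R.integral_content_measure_partition[OF that g] by (simp add: Int_assoc)
  have regPR: "regular_open (P \<inter> R)" if "regular_partition \<P>" "P \<in> \<P>" for P \<P>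
    using that R regular_open_Int regular_partition_regular by blast
  have upper: "I \<le> ?I" if I: "I \<in> ?S" for I
  proof -
    obtain f \<P> r where \<P>: "regular_partition \<P>" and f: "\<forall>P\<in>\<P>. \<forall>x\<in>P. f x = r P" "\<forall>x\<in>R. f x \<le> g x"
      and I: "I = (\<Sum>P\<in>\<P>. r P * c (P \<inter> R))"
      using I unfolding has_simple_fint_def by blast
    have "r P * c (P \<inter> R) \<le> (LINT x|content_measure (\<lambda>Q. c (Q \<inter> (P \<inter> R))). g x)" if "P \<in> \<P>" for P
      using f that by (intro integral_restrict_bounds(1) regPR[OF \<P>] g) auto
    then show ?thesis unfolding I sum[OF \<P>] by (rule sum_mono)
  qed
  have bddg: "bounded (range g)" by (rule continuous_imp_borel_bounded(2)[OF g])
  then obtain M where M: "\<And>x. \<bar>g x\<bar> \<le> M" by (auto simp: bounded_iff)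
  have approx: "\<exists>I\<in>?S. ?I \<le> I + e * c R" if e: "e > 0" for e
  proof -
    obtain \<P> where \<P>: "regular_partition \<P>"
      and osc: "\<And>P x y. P \<in> \<P> \<Longrightarrow> x \<in> P \<Longrightarrow> y \<in> P \<Longrightarrow> g x \<le> g y + e / 2"
      using regular_partition_fine[OF g bddg half_gt_zero[OF e]] by blast
    \<comment> \<open>A sample value lowered by the oscillation bound \<open>e / 2\<close> lies
      below \<open>g\<close> on the whole cell, and by at most \<open>e\<close>.\<close>
    define r where "r P = g (SOME x. x \<in> P) - e / 2" for P
    have r: "r P \<le> g x" "g x \<le> r P + e" if "P \<in> \<P>" "x \<in> P" for P x
      using osc[OF that(1) that(2), of "SOME x. x \<in> P"] osc[OF that(1) _ that(2), of "SOME x. x \<in> P"]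
        someI[of "\<lambda>x. x \<in> P" x] that by (auto simp: r_def)
    \<comment> \<open>The inequality with \<open>g\<close> is required off the cells too; the
      default \<open>- M\<close> lies below \<open>g\<close> everywhere and keeps the range
      finite.\<close>
    define f where "f x = (if x \<in> \<Union>\<P> then r (THE P. P \<in> \<P> \<and> x \<in> P) else - M)" for x
    have f: "f x = r P" if "P \<in> \<P>" "x \<in> P" for P x
    proof -
      have "(THE P. P \<in> \<P> \<and> x \<in> P) = P"
      proof (rule the_equality)
        show "P' = P" if "P' \<in> \<P> \<and> x \<in> P'" for P'
          using that \<open>P \<in> \<P>\<close> \<open>x \<in> P\<close> by (metis regular_partition_unique_cell[OF \<P>])
      qed (use that in simp)
      then show ?thesis using that by (auto simp: f_def)
    qed
    have fle: "f x \<le> g x" for x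
    proof (cases "x \<in> \<Union>\<P>")
      case True
      then show ?thesis using f r by (metis UnionE)
    next
      case False
      then show ?thesis using M[of x] by (simp add: f_def)
    qed
    have "range f \<subseteq> insert (- M) (r ` \<P>)"
    proof (rule image_subsetI)
      fix x
      show "f x \<in> insert (- M) (r ` \<P>)"
      proof (cases "x \<in> \<Union>\<P>")
        case True
        then show ?thesis using f by blast
      qed (simp add: f_def)
    qed
    then have "bounded (range f)"
      using regular_partition_finite[OF \<P>] 
      by (intro finite_imp_bounded) (auto dest: finite_subset)
    moreover have "has_simple_fint c R f (\<Sum>P\<in>\<P>. r P * c (P \<inter> R))"
      unfolding has_simple_fint_def using \<P> f by blast
    ultimately have S: "(\<Sum>P\<in>\<P>. r P * c (P \<inter> R)) \<in> ?S" using fle by blast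
    have "?I \<le> (\<Sum>P\<in>\<P>. (r P + e) * c (P \<inter> R))"
      unfolding sum[OF \<P>]
    proof (rule sum_mono)
      fix P assume P: "P \<in> \<P>"
      show "(LINT x|content_measure (\<lambda>Q. c (Q \<inter> (P \<inter> R))). g x) \<le> (r P + e) * c (P \<inter> R)"
        using r[OF P] by (intro integral_restrict_bounds(2) regPR[OF \<P> P] g) auto
    qed
    also have "\<dots> = (\<Sum>P\<in>\<P>. r P * c (P \<inter> R)) + e * c R"
      using partition_sum[OF R \<P>] by (simp add: distrib_right sum.distrib sum_distrib_left Int_commute)
    finally show ?thesis using S by blast
  qed
  have bdd: "bdd_above ?S" using upper unfolding bdd_above_def by blast
  have ne: "?S \<noteq> {}" using approx[OF zero_less_one] by blast
  have "?I \<le> fint c R g"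
  proof (rule field_le_epsilon)
    fix e :: real assume e: "e > 0"
    have cR: "0 \<le> c R" by (rule nonneg[OF R])
    \<comment> \<open>The 1 in the denominator keeps \<open>d\<close> defined and positive when
      \<open>c R\<close> is 0, while \<open>d * c R\<close> stays at most \<open>e\<close>.\<close>
    define d where "d = e / (1 + c R)"
    have "d > 0" using e cR by (simp add: d_def)
    then obtain I where I: "I \<in> ?S" "?I \<le> I + d * c R" using approx by blast
    have "d * c R \<le> e"
      using e cR by (simp add: d_def field_simps)
    moreover have "I \<le> fint c R g"
      unfolding fint_def using I(1) bdd by (rule cSup_upper)
    ultimately show "?I \<le> fint c R g + e" using I(2) by linarith
  qed
  moreover have "fint c R g \<le> ?I"
    unfolding fint_def using ne upper by (rule cSup_least)
  ultimately show ?thesis by simp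
qed

end

text \<open>The union of the cells is dense and \<open>Q\<close> is open, so the traces of the cells
  are dense in \<open>Q\<close> and join to \<open>Q\<close>; additivity of the content applies to
  them.\<close>

lemma reg_content_Int_partition:
  assumes \<mu>: "reg_content \<mu>" and Q: "regular_open Q" and \<P>: "regular_partition \<P>"
  shows "\<mu> Q = (\<Sum>P\<in>\<P>. \<mu> (Q \<inter> P))"
proof -
  have add: "finite \<R> \<Longrightarrow> \<forall>R\<in>\<R>. regular_open R \<Longrightarrow> disjoint \<R> \<Longrightarrow> \<mu> (reg_Join \<R>) = (\<Sum>R\<in>\<R>. \<mu> R)" for \<R>
    using \<mu> unfolding reg_content_def by blast
  have "\<mu> {} = 0" using add[of "{}"] by (simp add: reg_Join_empty)
  have "Q \<subseteq> closure (Q \<inter> \<Union>\<P>)"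
    using open_Int_closure_subset[OF regular_open_imp_open[OF Q], of "\<Union>\<P>"]
    by (simp add: regular_partition_dense[OF \<P>])
  then have "closure (Q \<inter> \<Union>\<P>) = closure Q"
    by (intro antisym closure_mono closure_minimal) auto
  moreover have "\<Union>((\<inter>) Q ` \<P>) = Q \<inter> \<Union>\<P>" by auto
  ultimately have "reg_Join ((\<inter>) Q ` \<P>) = Q"
    using Q by (simp add: reg_Join_def regular_open_def)
  moreover have "disjoint ((\<inter>) Q ` \<P>)"
    using \<P> by (fastforce simp: regular_partition_def disjoint_def)
  ultimately have "\<mu> Q = (\<Sum>R\<in>(\<inter>) Q ` \<P>. \<mu> R)"
    using add[of "(\<inter>) Q ` \<P>"] Q regular_partition_regular[OF \<P>] regular_partition_finite[OF \<P>]
    by (auto intro: regular_open_Int)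
  also have "\<dots> = (\<Sum>P\<in>\<P>. \<mu> (Q \<inter> P))"
  \<comment> \<open>Distinct cells can have the same trace on \<open>Q\<close> only if that trace is
    empty, where the content is 0.\<close>
  proof (subst sum.reindex_nontrivial)
    fix P P' assume "P \<in> \<P>" "P' \<in> \<P>" "P \<noteq> P'" "Q \<inter> P = Q \<inter> P'"
    moreover from this have "P \<inter> P' = {}"
      using regular_partition_unique_cell[OF \<P>] by blast
    ultimately have "Q \<inter> P = {}" by blast
    then show "\<mu> (Q \<inter> P) = 0" using \<open>\<mu> {} = 0\<close> by simp
  qed (simp_all add: regular_partition_finite[OF \<P>])
  finally show ?thesis .
qed

lemma compact_regular_content_reg_content:
  fixes \<mu> :: "'a::t2_space set \<Rightarrow> real"
  assumes "compact (UNIV :: 'a set)" "reg_content \<mu>"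
  shows "compact_regular_content \<mu>"
  by unfold_locales (use assms reg_content_Int_partition in \<open>auto simp: reg_content_def\<close>)

subsection \<open>Uniqueness of normal measures\<close>

lemma normal_measure_outer_regular:
  assumes "finite_measure M" "normal_measure M" "B \<in> sets borel" "e > 0"
  obtains V where "open V" "B \<subseteq> V" "measure M V \<le> measure M B + e"
proof -
  interpret finite_measure M by fact
  have "emeasure M B < ennreal (measure M B + e)"
    using assms(4) by (simp add: emeasure_eq_measure ennreal_lessI)
  moreover have "emeasure M B = (INF V\<in>{V. open V \<and> B \<subseteq> V}. emeasure M V)"
    using assms(2,3) unfolding normal_measure_def by blast
  ultimately obtain V where "open V" "B \<subseteq> V" "emeasure M V < ennreal (measure M B + e)"
    by (auto simp: INF_less_iff)
  then show thesis
    using assms(4) by (intro that) (auto simp: emeasure_eq_measure ennreal_less_iff simp del: ennreal_plus)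
qed

text \<open>A Urysohn function between \<open>C\<close> and a nearly optimal open \<open>V\<close>
  transports the bound: its integral is at least the measure of \<open>C\<close> under
  \<open>M\<close> and at most that of \<open>V\<close> under \<open>N\<close>.\<close>

lemma measure_le_of_integral_eq:
  fixes M N :: "'a::t2_space measure"
  assumes comp: "compact (UNIV :: 'a set)"
    and M: "finite_measure M" "sets M = sets borel" and N: "finite_measure N" "sets N = sets borel"
    and eq: "\<And>f :: 'a \<Rightarrow> real. continuous_on UNIV f \<Longrightarrow> integral\<^sup>L M f = integral\<^sup>L N f"
    and N_outer: "\<And>e. e > 0 \<Longrightarrow> \<exists>V. open V \<and> C \<subseteq> V \<and> measure N V \<le> measure N C + e"
    and C: "closed C"
  shows "measure M C \<le> measure N C"
proof (rule field_le_epsilon)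
  interpret M: finite_measure M by fact
  interpret N: finite_measure N by fact
  fix e :: real assume "e > 0"
  then obtain V where V: "open V" "C \<subseteq> V" "measure N V \<le> measure N C + e"
    using N_outer by blast
  obtain f :: "'a \<Rightarrow> real" where f: "continuous_on UNIV f" "indicat_real C \<le> f" "f \<le> indicat_real V"
    using urysohn_function[OF comp C V(1,2)] .
  have meas: "f \<in> borel_measurable M" "f \<in> borel_measurable N"
    using borel_measurable_continuous_onI[OF f(1)] M(2) N(2) by (auto simp: measurable_def sets_eq_imp_space_eq)
  have bound: "norm (f x) \<le> 1" for x
    using f(2,3) by (auto simp: le_fun_def intro: order_trans[OF _ indicator_le_1]
        dest!: spec[of _ x] split: split_indicator_asm)
  have "C \<in> sets M" "V \<in> sets N" using M(2) N(2) C V by auto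
  then have "measure M C = (LINT x|M. indicator C x)"
    by simp
  also have "\<dots> \<le> (LINT x|M. f x)"
    using f(2) bound meas \<open>C \<in> sets M\<close>
    by (intro integral_mono M.integrable_const_bound[where B=1]) (auto simp: le_fun_def)
  also have "\<dots> = (LINT x|N. f x)" by (rule eq[OF f(1)])
  also have "\<dots> \<le> (LINT x|N. indicator V x)"
    using f(3) bound meas \<open>V \<in> sets N\<close>
    by (intro integral_mono N.integrable_const_bound[where B=1]) (auto simp: le_fun_def)
  also have "\<dots> = measure N V" using \<open>V \<in> sets N\<close> by simp
  finally show "measure M C \<le> measure N C + e" using V by simp
qed

text \<open>Two one-sided comparisons give equality on closed sets, an intersection-stable generator
  of the Borel sets. Outer approximation is asked for closed sets, in the form that
  \<open>density_outer_regular\<close> supplies.\<close>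

lemma measure_eqI_continuous:
  fixes M N :: "'a::t2_space measure"
  assumes comp: "compact (UNIV :: 'a set)"
    and M: "finite_measure M" "sets M = sets borel" and N: "finite_measure N" "sets N = sets borel"
    and eq: "\<And>f :: 'a \<Rightarrow> real. continuous_on UNIV f \<Longrightarrow> integral\<^sup>L M f = integral\<^sup>L N f"
    and M_outer: "\<And>C e. closed C \<Longrightarrow> e > 0 \<Longrightarrow> \<exists>V. open V \<and> C \<subseteq> V \<and> measure M V \<le> measure M C + e"
    and N_outer: "\<And>C e. closed C \<Longrightarrow> e > 0 \<Longrightarrow> \<exists>V. open V \<and> C \<subseteq> V \<and> measure N V \<le> measure N C + e"
  shows "M = N"
proof -
  interpret M: finite_measure M by fact
  interpret N: finite_measure N by fact
  have borel: "sets borel = sigma_sets UNIV {C :: 'a set. closed C}"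
    unfolding borel_eq_closed by (rule sets_measure_of) auto
  have closed_eq: "measure M C = measure N C" if "closed C" for C
    by (intro antisym measure_le_of_integral_eq[OF comp M N] measure_le_of_integral_eq[OF comp N M])
       (use that eq M_outer N_outer in \<open>auto simp: eq\<close>)
  show ?thesis
  proof (rule measure_eqI_generator_eq[where E="{C. closed C}" and \<Omega>=UNIV and A="\<lambda>_. UNIV"])
    show "Int_stable {C :: 'a set. closed C}" by (auto simp: Int_stable_def)
    show "emeasure M C = emeasure N C" if "C \<in> {C. closed C}" for C
      using that by (simp add: M.emeasure_eq_measure N.emeasure_eq_measure closed_eq)
  qed (use M N borel in auto)
qed

text \<open>As \<open>h\<close> is at most 1, the excess \<open>V - C\<close> has no more mass under
  \<open>D\<close> than under \<open>M\<close>, so a \<open>V\<close> good for \<open>M\<close> is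
  good for \<open>D\<close>.\<close>

lemma density_outer_regular:
  fixes M :: "'a::t2_space measure" and h :: "'a \<Rightarrow> real"
  assumes M: "finite_measure M" "normal_measure M" and h: "h \<in> borel_measurable M" "\<And>x. h x \<in> {0..1}"
    and C: "closed C" and "e > 0"
  defines "D \<equiv> density M (\<lambda>x. ennreal (h x))"
  shows "finite_measure D" "\<exists>V. open V \<and> C \<subseteq> V \<and> measure D V \<le> measure D C + e"
proof -
  interpret M: finite_measure M by fact
  have sets: "sets M = sets borel" using M(2) by (simp add: normal_measure_def)
  have le: "emeasure D A \<le> emeasure M A" if "A \<in> sets borel" for A
  proof -
    have A: "A \<in> sets M" using that sets by simp
    have "emeasure D A \<le> (\<integral>\<^sup>+x. indicator A x \<partial>M)"
      unfolding D_def using h A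
      by (subst emeasure_density) (auto simp del: nn_integral_indicator intro!: nn_integral_mono split: split_indicator)
    then show ?thesis using A by simp
  qed
  have sp: "space M = UNIV" using sets sets_eq_imp_space_eq by fastforce
  then have "space D = UNIV" by (simp add: D_def)
  then show D: "finite_measure D"
    using le[of UNIV] M.emeasure_finite[of UNIV] by (intro finite_measureI) (auto simp: top_unique)
  interpret D: finite_measure D by fact
  obtain V where V: "open V" "C \<subseteq> V" "measure M V \<le> measure M C + e"
    using normal_measure_outer_regular[OF M borel_closed[OF C] \<open>e > 0\<close>] .
  have VC: "V - C \<in> sets borel" "V \<in> sets borel" "C \<in> sets borel" using V C by auto
  have "measure D V - measure D C = measure D (V - C)"
    using VC V by (subst D.finite_measure_Diff) (auto simp: D_def sets)
  also have "\<dots> \<le> measure M (V - C)"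
    using le[OF VC(1)] by (simp add: D.emeasure_eq_measure M.emeasure_eq_measure)
  also have "\<dots> = measure M V - measure M C"
    using VC V by (subst M.finite_measure_Diff) (auto simp: sets)
  finally show "\<exists>V. open V \<and> C \<subseteq> V \<and> measure D V \<le> measure D C + e" using V by fastforce
qed

section \<open>The liminal density structure of a content\<close>

context compact_regular_content
begin

text \<open>The closure of \<open>R\<close> is the disjoint union of \<open>R\<close>, where the
  density is 1, and its frontier. This splits an integral over the restricted content into its
  interior and boundary terms.\<close>

lemma AE_content_density_split:
  assumes "regular_open R"
  shows "AE x in content_measure c.
    content_density c R x = indicator R x + indicator (frontier R) x * content_density c R x"
  using content_density_inside[OF assms] content_density_outside[OF assms]
proof eventually_elim
  case (elim x)
  have "closure R = R \<union> frontier R" "R \<inter> frontier R = {}"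
    using closure_subset[of R] regular_open_imp_open[OF assms]
    by (auto simp: frontier_def interior_open)
  then show ?case using elim by (auto simp: indicator_def)
qed

lemma liminal_density_structure_content_density:
  "liminal_density_structure (content_measure c) (content_density c)"
  unfolding liminal_density_structure_def
proof (intro conjI allI impI ballI)
  fix R :: "'a set" and x assume R: "regular_open R"
  have "bounded (range (\<lambda>x. indicator (frontier R) x *\<^sub>R content_density c R x))"
    unfolding bounded_iff by (rule exI[of _ 1]) (auto simp: indicator_def)
  then show "set_integrable (content_measure c) (frontier R) (content_density c R)"
    unfolding set_integrable_def by (intro integrable_content_measure) auto
  show "content_density c R x \<in> {0..1}" by simp
next
  fix \<P> :: "'a set set" assume \<P>: "regular_partition \<P>"
  have "AE x in content_measure c. \<forall>P\<in>\<P>. content_density c P x =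
      indicator P x + indicator (frontier P) x * content_density c P x"
    using regular_partition_regular[OF \<P>]
    by (intro AE_finite_allI regular_partition_finite[OF \<P>] AE_content_density_split)
  with content_density_partition[OF \<P>]
  show "AE x in content_measure c. x \<in> (\<Union>R\<in>\<P>. frontier R) \<longrightarrow>
      (\<Sum>R\<in>\<P>. indicat_real (frontier R) x * content_density c R x) = 1"
  proof eventually_elim
    case (elim x)
    show ?case
    proof
      assume "x \<in> (\<Union>R\<in>\<P>. frontier R)"
      then obtain R where R: "R \<in> \<P>" "x \<in> frontier R" by blast
      \<comment> \<open>A frontier point of one cell lies in no cell: its own is open, and the
        others are disjoint from its closure. Hence only frontier terms remain in the sum of
        densities.\<close>
      have "x \<notin> P" if P: "P \<in> \<P>" for P
      proof (cases "P = R")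
        case True
        then show ?thesis
          using R regular_partition_regular[OF \<P> P]
          by (auto simp: frontier_def interior_open regular_open_imp_open)
      next
        case False
        then have "P \<inter> R = {}" using P R regular_partition_unique_cell[OF \<P>] by blast
        then have "P \<inter> closure R = {}"
          using regular_partition_regular[OF \<P> P] by (rule regular_open_disjoint_closure[rotated])
        then show ?thesis using R by (auto simp: frontier_def)
      qed
      then have "(\<Sum>R\<in>\<P>. indicat_real (frontier R) x * content_density c R x) = (\<Sum>R\<in>\<P>. content_density c R x)"
        using elim by (intro sum.cong refl) (metis add_0 indicator_simps(2))
      then show "(\<Sum>R\<in>\<P>. indicat_real (frontier R) x * content_density c R x) = 1"
        using elim by simp
    qed
  qed
qed

lemma fint_content_density:
  assumes R: "regular_open R" and f: "continuous_on UNIV f"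
  shows "fint c R f = (LINT x:R|content_measure c. f x) + (LINT x:frontier R|content_measure c. f x * content_density c R x)"
proof -
  note [measurable] = continuous_imp_borel_bounded(1)[OF f] borel_open[OF regular_open_imp_open[OF R]]
    borel_closed[OF frontier_closed[of R]]
  obtain B where B: "\<And>x. norm (f x) \<le> B"
    using continuous_imp_borel_bounded(2)[OF f] by (auto simp: bounded_iff)
  have B': "\<bar>f x * content_density c R x\<bar> \<le> B" for x
    using mult_mono[OF B[of x], of "content_density c R x" 1] B[of x]
    by (auto simp: abs_mult)
  have "0 \<le> B" using B[of undefined] norm_ge_zero order_trans by blast
  have int: "integrable (content_measure c) (\<lambda>x. indicator R x * f x)"
      "integrable (content_measure c) (\<lambda>x. indicator (frontier R) x * (f x * content_density c R x))"
  proof -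
    have "bounded (range (\<lambda>x. indicator R x * f x))"
        "bounded (range (\<lambda>x. indicator (frontier R) x * (f x * content_density c R x)))"
      using B B' \<open>0 \<le> B\<close> by (auto intro!: exI[of _ B] simp: bounded_iff indicator_def)
    then show "integrable (content_measure c) (\<lambda>x. indicator R x * f x)"
        "integrable (content_measure c) (\<lambda>x. indicator (frontier R) x * (f x * content_density c R x))"
      by (intro integrable_content_measure; measurable)+
  qed
  have "fint c R f = (LINT x|content_measure c. content_density c R x * f x)"
    by (simp add: fint_eq_integral[OF R f] integral_content_measure_restrict R)
  also have "\<dots> = (LINT x|content_measure c. indicator R x * f x +
      indicator (frontier R) x * (f x * content_density c R x))"
  proof (rule integral_cong_AE)
    show "AE x in content_measure c. content_density c R x * f x =
        indicator R x * f x + indicator (frontier R) x * (f x * content_density c R x)"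
      using AE_content_density_split[OF R]
      by eventually_elim (metis (no_types, lifting) distrib_right mult.assoc mult.commute)
  qed measurable
  finally show ?thesis
    using int by (simp add: set_lebesgue_integral_def)
qed

lemma fint_const_1:
  assumes R: "regular_open R"
  shows "fint c R (\<lambda>_. 1) = c R"
proof -
  interpret R: compact_regular_content "\<lambda>Q. c (Q \<inter> R)" using R by (rule restrict)
  show ?thesis
    using R.emeasure_content_measure_UNIV nonneg[OF R]
    by (simp add: fint_eq_integral[OF R] measure_def)
qed

text \<open>The identity for \<open>c R\<close> is the integral formula applied to the constant
  1.\<close>

lemma liminal_representation_content_density:
  "liminal_representation c (content_measure c) (content_density c)"
proof -
  interpret finite_measure "content_measure c" by (rule finite_measure_content_measure)
  have "c R = measure (content_measure c) R + (LINT x:frontier R|content_measure c. content_density c R x)"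
    if R: "regular_open R" for R
    using fint_content_density[OF R, of "\<lambda>_. 1"] regular_open_imp_open[OF R]
    by (simp add: fint_const_1[OF R] set_lebesgue_integral_def)
  then show ?thesis
    unfolding liminal_representation_def
    using liminal_density_structure_content_density fint_content_density by blast
qed

end

section \<open>Existence and uniqueness of the measure and of its liminal density structure\<close>

theorem corollary6p7:
  fixes \<mu> :: "'a::t2_space set \<Rightarrow> real"
  assumes "compact (UNIV :: 'a set)"
    and "reg_content \<mu>"
  shows "\<exists>\<nu>. represents_content \<mu> \<nu> \<and>
           (\<forall>\<nu>'. represents_content \<mu> \<nu>' \<longrightarrow> \<nu>' = \<nu>) \<and>
           (\<exists>\<phi>. liminal_representation \<mu> \<nu> \<phi> \<and>
              (\<forall>\<psi>. liminal_representation \<mu> \<nu> \<psi> \<longrightarrow> liminal_eq \<nu> \<psi> \<phi>))"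
proof -
  interpret compact_regular_content \<mu>
    using assms by (rule compact_regular_content_reg_content)
  interpret finite_measure "content_measure \<mu>" by (rule finite_measure_content_measure)
  have rep: "represents_content \<mu> (content_measure \<mu>)"
    unfolding represents_content_def
  proof (intro conjI allI impI normal_measure_content_measure)
    show "prob_space (content_measure \<mu>)"
      using assms(2) by (intro prob_spaceI) (simp add: emeasure_content_measure_UNIV reg_content_def)
    show "fint \<mu> UNIV f = (LINT x|content_measure \<mu>. f x)" if "continuous_on UNIV f" for f
      using fint_eq_integral[OF regular_open_UNIV that] by simp
  qed
  \<comment> \<open>Any representing measure gives each continuous function the same integral
    \<open>fint \<mu> UNIV f\<close>, and outer regularity does the rest.\<close>
  have unique: "\<nu> = content_measure \<mu>" if \<nu>: "represents_content \<mu> \<nu>" for \<nu>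
  proof -
    have normal: "normal_measure \<nu>" "finite_measure \<nu>"
      using \<nu> by (auto simp: represents_content_def prob_space_def)
    show ?thesis
    proof (rule measure_eqI_continuous[OF assms(1)])
      show "integral\<^sup>L \<nu> f = integral\<^sup>L (content_measure \<mu>) f" if "continuous_on UNIV f" for f :: "'a \<Rightarrow> real"
        using that \<nu> rep by (simp add: represents_content_def)
      show "\<exists>V. open V \<and> C \<subseteq> V \<and> measure \<nu> V \<le> measure \<nu> C + e" if "closed C" "e > 0" for C e
        using normal_measure_outer_regular[OF normal(2,1) borel_closed] that by metis
      show "\<exists>V. open V \<and> C \<subseteq> V \<and> measure (content_measure \<mu>) V \<le> measure (content_measure \<mu>) C + e"
        if "closed C" "e > 0" for C e
        using normal_measure_outer_regular[OF finite_measure_axioms normal_measure_content_measure borel_closed] that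
        by metis
    qed (use normal finite_measure_axioms in \<open>auto simp: normal_measure_def\<close>)
  qed
  have "liminal_eq (content_measure \<mu>) \<psi> (content_density \<mu>)"
    if \<psi>: "liminal_representation \<mu> (content_measure \<mu>) \<psi>" for \<psi>
    unfolding liminal_eq_def
  proof (intro allI impI)
    fix R :: "'a set" assume R: "regular_open R"
    \<comment> \<open>With \<open>\<theta> R\<close> extended by 0 to \<open>h \<theta>\<close>, the
      formula for \<open>fint \<mu> R f\<close> fixes the integral of every continuous
      \<open>f\<close> against \<open>D \<theta>\<close>. This fixes the measure
      \<open>D \<theta>\<close>, and so \<open>h \<theta>\<close> almost everywhere.\<close>
    define h where "h \<theta> x = indicator (frontier R) x * \<theta> R x" for \<theta> :: "'a set \<Rightarrow> 'a \<Rightarrow> real" and x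
    define D where "D \<theta> = density (content_measure \<mu>) (\<lambda>x. ennreal (h \<theta> x))" for \<theta>
    have meas: "h \<theta> \<in> borel_measurable (content_measure \<mu>)" and range: "h \<theta> x \<in> {0..1}"
      and fint: "continuous_on UNIV f \<Longrightarrow> fint \<mu> R f = (LINT x:R|content_measure \<mu>. f x) + integral\<^sup>L (D \<theta>) f"
      if "liminal_representation \<mu> (content_measure \<mu>) \<theta>" for \<theta> x f
    proof -
      have \<theta>: "set_integrable (content_measure \<mu>) (frontier R) (\<theta> R)" "\<forall>x\<in>frontier R. \<theta> R x \<in> {0..1}"
        using that R by (auto simp: liminal_representation_def liminal_density_structure_def)
      show m: "h \<theta> \<in> borel_measurable (content_measure \<mu>)"
        using \<theta>(1) unfolding set_integrable_def h_def by (simp add: integrable_iff_bounded)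
      show *: "h \<theta> x \<in> {0..1}" for x
        using \<theta>(2) by (auto simp: h_def indicator_def)
      assume f: "continuous_on UNIV f"
      have "integral\<^sup>L (D \<theta>) f = (LINT x|content_measure \<mu>. h \<theta> x *\<^sub>R f x)"
        unfolding D_def using m * continuous_imp_borel_bounded(1)[OF f] by (intro integral_density) auto
      also have "\<dots> = (LINT x:frontier R|content_measure \<mu>. f x * \<theta> R x)"
        unfolding set_lebesgue_integral_def h_def by (intro Bochner_Integration.integral_cong) auto
      finally show "fint \<mu> R f = (LINT x:R|content_measure \<mu>. f x) + integral\<^sup>L (D \<theta>) f"
        using that R f by (simp add: liminal_representation_def)
    qed
    note reps = \<psi> liminal_representation_content_density
    have outer: "finite_measure (D \<theta>)" "closed C \<Longrightarrow> e > 0 \<Longrightarrow> \<exists>V. open V \<and> C \<subseteq> V \<and> measure (D \<theta>) V \<le> measure (D \<theta>) C + e"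
      if "liminal_representation \<mu> (content_measure \<mu>) \<theta>" for \<theta> C e
      using density_outer_regular[OF finite_measure_axioms normal_measure_content_measure meas[OF that] range[OF that]]
        closed_UNIV zero_less_one unfolding D_def by blast+
    have "D \<psi> = D (content_density \<mu>)"
    proof (rule measure_eqI_continuous[OF assms(1)])
      show "integral\<^sup>L (D \<psi>) f = integral\<^sup>L (D (content_density \<mu>)) f" if "continuous_on UNIV f" for f :: "'a \<Rightarrow> real"
        using fint[OF reps(1) that] fint[OF reps(2) that] by simp
    qed (use outer[OF reps(1)] outer[OF reps(2)] in \<open>auto simp: D_def\<close>)
    then have "AE x in content_measure \<mu>. ennreal (h \<psi> x) = ennreal (h (content_density \<mu>) x)"
      unfolding D_def using meas[OF reps(1)] meas[OF reps(2)] by (intro density_unique) auto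
    then show "AE x in content_measure \<mu>. x \<in> frontier R \<longrightarrow> \<psi> R x = content_density \<mu> R x"
    proof eventually_elim
      case (elim x)
      then have "h \<psi> x = h (content_density \<mu>) x"
        using range[OF reps(1), of x] range[OF reps(2), of x] by simp
      then show ?case by (auto simp: h_def)
    qed
  qed
  then show ?thesis
    using rep unique liminal_representation_content_density by blast
qed

end
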